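(* Let $\pi_n$ be the unique stationary distribution of the gap process. There exist $\kappa\in(0,\infty)$ and $\beta\in(0,1)$ such that for every $t>0$, $$\sup_{\mathbf{y}\in\mathbb{R}_+^{n-1}}\|\mathbb{P}^t(\mathbf{y},\cdot)-\pi_n\|_{TV}\le\kappa\beta^t.$$
   Context: Fix $n\ge 2$ and a probability law $\theta$ on $(0,\infty)$ with $\int z\,\theta(dz)=1$. The $n$-particle Stochastic Follow-the-Leader system $\mathbf{X}=(X_1,\dots,X_n)$ on $\mathbb{R}$, with $X_n(t)<\dots<X_1(t)$, evolves as a pure jump Markov process: the leader $X_1$ jumps forward at rate $1$ with i.i.d. jump sizes of law $\theta$; for $i\ge 2$, particle $X_i$ jumps at rate $X_{i-1}-X_i$ to a location chosen uniformly in $(X_i,X_{i-1})$. The gap process is $Y_i(t)=X_i(t)-X_{i+1}(t)$, $i=1,\dots,n-1$; it is a Markov process on $\mathbb{R}_+^{n-1}$ whose generator acts on bounded measurable $f$ by $$\mathcal{L}_nf(\mathbf{y})=y_{n-1}\mathbb{E}_U[f(\mathbf{y}-y_{n-1}Ue_{n-1})-f(\mathbf{y})]+\sum_{i=1}^{n-2}y_i\mathbb{E}_U[f(\mathbf{y}+y_iU(e_{i+1}-e_i))-f(\mathbf{y})]+\mathbb{E}_\theta[f(\mathbf{y}+Ze_1)-f(\mathbf{y})],$$ where $U\sim\mathrm{U}(0,1)$, $Z\sim\theta$. $\mathbb{P}_{\mathbf{y}}$ denotes the law of $\mathbf{Y}$ started at $\mathbf{y}$ and $\mathbb{P}^t(\mathbf{y},A)=\mathbb{P}_{\mathbf{y}}(\mathbf{Y}(t)\in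 A)$. $\|\mu-\nu\|_{TV}=\sup_A|\mu(A)-\nu(A)|$. *)

theory Defs
  imports "HOL-Probability.Probability"
begin

definition gap_space :: "nat \<Rightarrow> (nat \<Rightarrow> real) set" where
  "gap_space n = {y \<in> extensional {1..n-1}. \<forall>i\<in>{1..n-1}. 0 \<le> y i}"

definition gap_measure :: "nat \<Rightarrow> (nat \<Rightarrow> real) measure" where
  "gap_measure n = restrict_space (PiM {1..n-1} (\<lambda>_. (borel :: real measure))) (gap_space n)"

text \<open>Total jump rate at y: 1 (leader) + sum of y_i (particle i+1 jumps at rate y_i).\<close>
definition total_rate :: "nat \<Rightarrow> (nat \<Rightarrow> real) \<Rightarrow> real" where
  "total_rate n y = 1 + (\<Sum>i\<in>{1..n-1}. y i)"

text \<open>Jump (rate) kernel applied to a nonnegative function f: this is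
  \<integral> f(z) J(y,dz), where J(y,.) is the jump measure of the generator L_n.\<close>
definition jump_op :: "nat \<Rightarrow> real measure \<Rightarrow> (nat \<Rightarrow> real) \<Rightarrow> ((nat \<Rightarrow> real) \<Rightarrow> ennreal) \<Rightarrow> ennreal" where
  "jump_op n \<theta> y f =
     ennreal (y (n-1)) * (\<integral>\<^sup>+ u. indicator {0..1} u * f (y(n-1 := y (n-1) - y (n-1) * u)) \<partial>lborel)
   + (\<Sum>i\<in>{1..n-2}. ennreal (y i) *
        (\<integral>\<^sup>+ u. indicator {0..1} u * f (y(i := y i - y i * u, Suc i := y (Suc i) + y i * u)) \<partial>lborel))
   + (\<integral>\<^sup>+ z. f (y(1 := y 1 + z)) \<partial>\<theta>)"

text \<open>Feller's minimal construction of the transition function of the pure jump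
  Markov process with generator L_n: ptrans_k t y A is the probability that the
  process started at y is in A at time t after exactly k jumps.\<close>
fun ptrans_k :: "nat \<Rightarrow> real measure \<Rightarrow> nat \<Rightarrow> real \<Rightarrow> (nat \<Rightarrow> real) \<Rightarrow> (nat \<Rightarrow> real) set \<Rightarrow> ennreal" where
  "ptrans_k n \<theta> 0 t y A = ennreal (exp (- total_rate n y * t)) * indicator A y"
| "ptrans_k n \<theta> (Suc k) t y A =
     (\<integral>\<^sup>+ s. indicator {0..t} s * ennreal (exp (- total_rate n y * s)) *
        jump_op n \<theta> y (\<lambda>z. ptrans_k n \<theta> k (t - s) z A) \<partial>lborel)"

definition Ptrans :: "nat \<Rightarrow> real measure \<Rightarrow> real \<Rightarrow> (nat \<Rightarrow> real) \<Rightarrow> (nat \<Rightarrow> real) set \<Rightarrow> real" where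
  "Ptrans n \<theta> t y A = enn2real (\<Sum>k. ptrans_k n \<theta> k t y A)"

definition stationary :: "nat \<Rightarrow> real measure \<Rightarrow> (nat \<Rightarrow> real) measure \<Rightarrow> bool" where
  "stationary n \<theta> \<pi> \<longleftrightarrow> prob_space \<pi> \<and> sets \<pi> = sets (gap_measure n) \<and>
     (\<forall>t\<ge>0. \<forall>A\<in>sets (gap_measure n).
        emeasure \<pi> A = (\<integral>\<^sup>+y. (\<Sum>k. ptrans_k n \<theta> k t y A) \<partial>\<pi>))"

end

theory Submission
  imports Defs
begin

text \<open>
  A uniform jump of the gap \<open>y i\<close> at rate \<open>y i\<close> has the Lebesgue measure on \<open>(0, y i)\<close> as its
  jump kernel. Two consequences drive the proof. First, the weighted sum \<open>V y = (\<Sum>i. (n - i) * y i)\<close>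
  has drift at most \<open>(n - 1) - \<epsilon> * V\<^sup>2\<close>, so that \<open>V / (1 + \<epsilon> * t * V) + (n - 1) * t\<close> is a supersolution of the
  backward equation: the gaps come down from infinity, and at time 1 the process lies in a fixed
  sublevel set of \<open>V\<close> with probability at least 1/2, whatever the initial state. Second, from that set
  one jump of the leader followed by one jump of each of the other particles, in order, produces a
  distribution that dominates a multiple of the Lebesgue measure on a small cube. Together this is
  Doeblin's condition at time 2 with no restriction on the initial state, so the oscillation of
  \<open>y \<mapsto> P t f y\<close> contracts geometrically. Non-explosion comes from the linear growth of the rate,
  and stationarity of the setwise limit from a layer-cake decomposition.
\<close>

text \<open>No paths are constructed. Transition probabilities are the sums of the iterates of an
  operator \<open>T\<close> that conditions on the first jump, and the probabilistic estimates are
  inequalities for \<open>T\<close>. The obstacle is the unbounded rate: mass might escape through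
  infinitely many jumps, and no single bound on the rate is available. Upper bounds therefore come
  from supersolutions, which dominate Feller's series by its minimality. Values in
  \<open>ennreal\<close> make Tonelli unconditional but forbid subtraction, so a drift inequality
  reads J f \<le> rate * f + drift. The uniform bound rests on two facts: v / (1 + \<epsilon> t v)
  solves v' = - \<epsilon> v^2 and stays below 1 / (\<epsilon> t) for every initial v, and it is
  concave in v, so that tangent lines carry the bound from the differential equation to jumps of
  random size.\<close>

text \<open>Otherwise the simplifier rewrites the index set \<open>{1..n-1}\<close>.\<close>

declare One_nat_def [simp del]

subsection \<open>Jump operator\<close>

locale follow_the_leader =
  fixes n :: nat and \<theta> :: "real measure"
  assumes n2: "n \<ge> 2"
    and theta_prob: "prob_space \<theta>" and theta_sets: "sets \<theta> = sets (borel :: real measure)"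
    and theta_pos: "emeasure \<theta> {0<..} = 1"
    and theta_int: "integrable \<theta> (\<lambda>z. z)" and theta_mean: "(\<integral>z. z \<partial>\<theta>) = 1"
begin

abbreviation S :: "(nat \<Rightarrow> real) measure" where
  "S \<equiv> PiM {1..n-1} (\<lambda>_. borel)"

abbreviation G :: "(nat \<Rightarrow> real) set" where
  "G \<equiv> gap_space n"

abbreviation rate :: "(nat \<Rightarrow> real) \<Rightarrow> real" where
  "rate \<equiv> total_rate n"

abbreviation J :: "(nat \<Rightarrow> real) \<Rightarrow> ((nat \<Rightarrow> real) \<Rightarrow> ennreal) \<Rightarrow> ennreal" where
  "J \<equiv> jump_op n \<theta>"

text \<open>\<open>hop i u\<close> is the jump of particle i + 1 over the fraction \<open>u\<close>
  of the gap in front of it. The last particle has nobody behind it, so its jump enlarges no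
  gap.\<close>

definition hop :: "nat \<Rightarrow> real \<Rightarrow> (nat \<Rightarrow> real) \<Rightarrow> nat \<Rightarrow> real" where
  "hop i u y = (if i = n - 1 then y(i := y i - y i * u)
                else y(i := y i - y i * u, Suc i := y (Suc i) + y i * u))"

definition lead :: "real \<Rightarrow> (nat \<Rightarrow> real) \<Rightarrow> nat \<Rightarrow> real" where
  "lead z y = y(1 := y 1 + z)"

lemma jump_op_hop:
  "J y f = (\<Sum>i\<in>{1..n-1}. ennreal (y i) * (\<integral>\<^sup>+u. indicator {0..1} u * f (hop i u y) \<partial>lborel))
         + (\<integral>\<^sup>+z. f (lead z y) \<partial>\<theta>)"
proof -
  have "{1..n-1} = insert (n-1) {1..n-2}" "n - 1 \<notin> {1..n-2}"
    using n2 by auto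
  then show ?thesis
    by (auto simp: jump_op_def hop_def lead_def intro!: arg_cong2[where f="(+)"] sum.cong)
qed

lemma sets_theta_cong [measurable_cong]: "sets \<theta> = sets borel"
  by (rule theta_sets)

lemma sigma_finite_theta: "sigma_finite_measure \<theta>"
  by (rule finite_measure.axioms(1)[OF prob_space.axioms(1)[OF theta_prob]])

lemma AE_theta_pos: "AE z in \<theta>. 0 < z"
proof -
  interpret prob_space \<theta> by (rule theta_prob)
  have "prob {0<..} = 1" using theta_pos by (simp add: measure_def)
  then show ?thesis using AE_prob_1[of "{0<..}"] by simp
qed

section \<open>Joint measurability of the jump operator\<close>

lemma measurable_upd:
  assumes "f \<in> measurable N S" "h \<in> borel_measurable N" "i \<in> {1..n-1}"
  shows "(\<lambda>x. (f x)(i := h x)) \<in> measurable N S"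
  by (rule measurable_fun_upd[where J="{1..n-1}"]) (use assms in auto)

lemma measurable_coord:
  assumes "f \<in> measurable N S" "i \<in> {1..n-1}"
  shows "(\<lambda>x. f x i) \<in> borel_measurable N"
  using measurable_compose[OF assms(1) measurable_component_singleton[OF assms(2)]] by simp

lemma measurable_hop:
  assumes f: "f \<in> measurable N S" and [measurable]: "h \<in> borel_measurable N" and i: "i \<in> {1..n-1}"
  shows "(\<lambda>x. hop i (h x) (f x)) \<in> measurable N S"
proof (cases "i = n - 1")
  case True
  note [measurable] = measurable_coord[OF f i]
  show ?thesis unfolding hop_def if_P[OF True] by (rule measurable_upd[OF f _ i]) measurable
next
  case False
  then have si: "Suc i \<in> {1..n-1}" using i by auto
  note [measurable] = measurable_coord[OF f i] measurable_coord[OF f si]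
  show ?thesis unfolding hop_def if_not_P[OF False]
    by (rule measurable_upd[OF measurable_upd[OF f _ i] _ si]; measurable)
qed

lemma measurable_jump_op:
  assumes [measurable]: "case_prod F \<in> borel_measurable (N \<Otimes>\<^sub>M S)" and g[measurable]: "g \<in> measurable N S"
  shows "(\<lambda>w. J (g w) (F w)) \<in> borel_measurable N"
proof -
  interpret \<theta>: sigma_finite_measure \<theta> by (rule sigma_finite_theta)
  have c: "(\<lambda>x. g x i) \<in> borel_measurable N" if "i \<in> {1..n-1}" for i
    using g that by (rule measurable_coord)
  have one: "(1::nat) \<in> {1..n-1}" using n2 by auto
  have hp: "(\<lambda>(x,u). F x (hop i u (g x))) \<in> borel_measurable (N \<Otimes>\<^sub>M lborel)" if "i \<in> {1..n-1}" for i
  proof -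
    have [measurable]: "(\<lambda>p. hop i (snd p) (g (fst p))) \<in> measurable (N \<Otimes>\<^sub>M lborel) S"
      by (rule measurable_hop) (use that in measurable)
    show ?thesis by measurable
  qed
  have [measurable]: "(\<lambda>p. lead (snd p) (g (fst p))) \<in> measurable (N \<Otimes>\<^sub>M \<theta>) S"
    unfolding lead_def by (rule measurable_upd) (use one c[OF one] in measurable)
  have "(\<lambda>w. \<integral>\<^sup>+z. F w (lead z (g w)) \<partial>\<theta>) \<in> borel_measurable N"
    by measurable
  moreover have "(\<lambda>w. ennreal (g w i) * (\<integral>\<^sup>+u. indicator {0..1} u * F w (hop i u (g w)) \<partial>lborel))
      \<in> borel_measurable N" if "i \<in> {1..n-1}" for i
  proof -
    note [measurable] = hp[OF that] c[OF that]
    show ?thesis by measurable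
  qed
  ultimately show ?thesis
    unfolding jump_op_hop by (intro borel_measurable_add borel_measurable_sum) auto
qed

section \<open>Invariance of the state spaces under jumps\<close>

lemma hop_space: "y \<in> space S \<Longrightarrow> i \<in> {1..n-1} \<Longrightarrow> hop i u y \<in> space S"
  by (auto simp: space_PiM PiE_iff extensional_def hop_def)

lemma lead_space: "y \<in> space S \<Longrightarrow> lead z y \<in> space S"
  using n2 by (auto simp: space_PiM PiE_iff extensional_def lead_def)

lemma gap_space_sub: "y \<in> G \<Longrightarrow> y \<in> space S"
  by (auto simp: gap_space_def space_PiM PiE_iff)

lemma gap_space_nonneg: "y \<in> G \<Longrightarrow> i \<in> {1..n-1} \<Longrightarrow> 0 \<le> y i"
  by (auto simp: gap_space_def)

lemma hop_gap_space:
  assumes "y \<in> G" "i \<in> {1..n-1}" "0 \<le> u" "u \<le> 1"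
  shows "hop i u y \<in> G"
proof -
  have "0 \<le> y i * u" "y i * u \<le> y i"
    using assms gap_space_nonneg[OF assms(1,2)] by (auto intro: mult_left_le)
  then show ?thesis using assms by (auto simp: gap_space_def hop_def extensional_def)
qed

lemma lead_gap_space:
  assumes "y \<in> G" "0 \<le> z"
  shows "lead z y \<in> G"
  using assms n2 by (auto simp: gap_space_def extensional_def lead_def)

lemma gap_space_sets: "G \<in> sets S"
proof -
  have "G = {y\<in>space S. \<forall>i\<in>{1..n-1}. 0 \<le> y i}"
    by (auto simp: gap_space_def space_PiM PiE_iff)
  also have "\<dots> \<in> sets S" by measurable
  finally show ?thesis .
qed

lemma sets_gap_measure: "A \<in> sets (gap_measure n) \<longleftrightarrow> A \<in> sets S \<and> A \<subseteq> G"
proof -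
  have "G \<inter> space S \<in> sets S" using gap_space_sets by auto
  then show ?thesis unfolding gap_measure_def by (auto simp: sets_restrict_space_iff)
qed

lemma measurable_rate [measurable]: "rate \<in> borel_measurable S"
  unfolding total_rate_def by measurable

lemma rate_ge_1: "y \<in> G \<Longrightarrow> 1 \<le> rate y"
  by (auto simp: total_rate_def intro!: sum_nonneg gap_space_nonneg)

lemma measurable_hop' [measurable]:
  "y \<in> space S \<Longrightarrow> i \<in> {1..n-1} \<Longrightarrow> (\<lambda>u. hop i u y) \<in> measurable borel S"
  by (rule measurable_hop) auto

lemma measurable_lead' [measurable]:
  "y \<in> space S \<Longrightarrow> (\<lambda>z. lead z y) \<in> measurable borel S"
  unfolding lead_def by (rule measurable_upd) (use n2 in auto)

text \<open>Tonelli for the jump kernel. Passed on to \<open>T\<close> and \<open>P\<close>, it is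
  used with counting measures (finite and countable additivity) and with Lebesgue measure
  (layer-cake formula), hence the general \<open>N\<close>.\<close>

lemma jump_op_nn_integral:
  assumes [measurable]: "case_prod F \<in> borel_measurable (N \<Otimes>\<^sub>M S)" and y[measurable]: "y \<in> space S"
    and N: "sigma_finite_measure N"
  shows "J y (\<lambda>z. \<integral>\<^sup>+w. F w z \<partial>N) = (\<integral>\<^sup>+w. J y (F w) \<partial>N)"
proof -
  interpret N: sigma_finite_measure N by (rule N)
  interpret \<theta>: sigma_finite_measure \<theta> by (rule sigma_finite_theta)
  interpret N1: pair_sigma_finite N "lborel :: real measure" ..
  interpret N2: pair_sigma_finite N \<theta> ..
  have m1: "(\<lambda>(w,u). F w (hop i u y)) \<in> borel_measurable (N \<Otimes>\<^sub>M lborel)" if "i \<in> {1..n-1}" for i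
    using that by measurable
  have m2[measurable]: "(\<lambda>(w,z). F w (lead z y)) \<in> borel_measurable (N \<Otimes>\<^sub>M \<theta>)"
    by measurable
  have hp: "ennreal (y i) * (\<integral>\<^sup>+u. indicator {0..1} u * (\<integral>\<^sup>+w. F w (hop i u y) \<partial>N) \<partial>lborel)
      = (\<integral>\<^sup>+w. ennreal (y i) * (\<integral>\<^sup>+u. indicator {0..1} u * F w (hop i u y) \<partial>lborel) \<partial>N)"
    if i: "i \<in> {1..n-1}" for i
  proof -
    note [measurable] = m1[OF i]
    have "(\<integral>\<^sup>+u. indicator {0..1} u * (\<integral>\<^sup>+w. F w (hop i u y) \<partial>N) \<partial>lborel)
        = (\<integral>\<^sup>+u. (\<integral>\<^sup>+w. indicator {0..1} u * F w (hop i u y) \<partial>N) \<partial>lborel)"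
      using i y by (intro nn_integral_cong nn_integral_cmult[symmetric]) (auto simp: hop_space)
    also have "\<dots> = (\<integral>\<^sup>+w. (\<integral>\<^sup>+u. indicator {0..1} u * F w (hop i u y) \<partial>lborel) \<partial>N)"
      by (rule N1.Fubini') measurable
    finally show ?thesis by (simp add: nn_integral_cmult)
  qed
  have "(\<integral>\<^sup>+z. (\<integral>\<^sup>+w. F w (lead z y) \<partial>N) \<partial>\<theta>) = (\<integral>\<^sup>+w. (\<integral>\<^sup>+z. F w (lead z y) \<partial>\<theta>) \<partial>N)"
    by (rule N2.Fubini') measurable
  moreover have "(\<lambda>w. ennreal (y i) * (\<integral>\<^sup>+u. indicator {0..1} u * F w (hop i u y) \<partial>lborel)) \<in> borel_measurable N"
    if "i \<in> {1..n-1}" for i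
  proof -
    note [measurable] = m1[OF that]
    show ?thesis by measurable
  qed
  moreover have "(\<lambda>w. \<integral>\<^sup>+z. F w (lead z y) \<partial>\<theta>) \<in> borel_measurable N"
    by measurable
  ultimately show ?thesis
    unfolding jump_op_hop
    by (subst nn_integral_add) (auto simp: nn_integral_sum hp)
qed

lemma jump_op_mono:
  assumes "y \<in> G" "\<And>z. z \<in> G \<Longrightarrow> f z \<le> g z"
  shows "J y f \<le> J y g"
  unfolding jump_op_hop
proof (intro add_mono sum_mono mult_left_mono)
  show "(\<integral>\<^sup>+z. f (lead z y) \<partial>\<theta>) \<le> (\<integral>\<^sup>+z. g (lead z y) \<partial>\<theta>)"
    using AE_theta_pos
    by (intro nn_integral_mono_AE) (auto elim!: eventually_mono intro!: assms(2) lead_gap_space[OF assms(1)])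
qed (auto intro!: nn_integral_mono assms(2) hop_gap_space[OF assms(1)] simp: indicator_def)

lemma jump_op_cmult:
  assumes [measurable]: "f \<in> borel_measurable S" and y[measurable]: "y \<in> space S"
  shows "J y (\<lambda>z. c * f z) = c * J y f"
  unfolding jump_op_hop distrib_left sum_distrib_left
  by (auto intro!: arg_cong2[where f="(+)"] sum.cong simp: nn_integral_cmult mult.left_commute[of _ c])

section \<open>Drift bounds from affine majorants\<close>

lemma nn_integral_affine_unit:
  fixes \<alpha> \<beta> :: real
  assumes "0 \<le> \<beta>" "\<beta> \<le> \<alpha>"
  shows "(\<integral>\<^sup>+u. indicator {0..1} u * ennreal (\<alpha> - \<beta> * u) \<partial>lborel) = ennreal (\<alpha> - \<beta> / 2)"
proof -
  have "(\<integral>\<^sup>+u. ennreal (\<alpha> - \<beta> * u) * indicator {0..1} u \<partial>lborel)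
      = ennreal ((\<alpha> * 1 - \<beta> * 1\<^sup>2 / 2) - (\<alpha> * 0 - \<beta> * 0\<^sup>2 / 2))"
  proof (rule nn_integral_FTC_Icc)
    fix u :: real assume "u \<in> {0..1}"
    moreover have "\<beta> * u \<le> \<beta>" using assms calculation by (auto intro: mult_left_le)
    ultimately show "0 \<le> \<alpha> - \<beta> * u" using assms by auto
    show "((\<lambda>u. \<alpha> * u - \<beta> * u\<^sup>2 / 2) has_real_derivative \<alpha> - \<beta> * u) (at u)"
      by (auto intro!: derivative_eq_intros)
  qed auto
  then show ?thesis by (simp add: mult.commute)
qed

lemma nn_integral_affine_theta:
  assumes "0 \<le> \<alpha>" "0 \<le> \<gamma>"
  shows "(\<integral>\<^sup>+z. ennreal (\<alpha> + \<gamma> * z) \<partial>\<theta>) = ennreal (\<alpha> + \<gamma>)"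
proof -
  interpret prob_space \<theta> by (rule theta_prob)
  have "(\<integral>\<^sup>+z. ennreal (\<alpha> + \<gamma> * z) \<partial>\<theta>) = ennreal (\<integral>z. \<alpha> + \<gamma> * z \<partial>\<theta>)"
    by (rule nn_integral_eq_integral)
      (use theta_int AE_theta_pos assms in \<open>auto elim!: eventually_mono\<close>)
  then show ?thesis using theta_int theta_mean by (simp add: prob_space)
qed

text \<open>In the applications \<open>\<alpha>\<close> is the value at \<open>y\<close>, and
  \<open>\<beta> i\<close> and \<open>\<gamma>\<close> bound the change caused by a jump. The means
  1/2 of the uniform law and 1 of \<open>\<theta>\<close> turn these slopes into the drift. The
  condition \<open>\<beta> i \<le> \<alpha>\<close> excludes truncation at 0.\<close>

lemma jump_op_affine_bound:
  fixes \<alpha> \<gamma> :: real and \<beta> :: "nat \<Rightarrow> real"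
  assumes y: "y \<in> G"
    and hp: "\<And>i u. i \<in> {1..n-1} \<Longrightarrow> 0 \<le> u \<Longrightarrow> u \<le> 1 \<Longrightarrow> f (hop i u y) \<le> ennreal (\<alpha> - \<beta> i * u)"
    and ld: "\<And>z. 0 \<le> z \<Longrightarrow> f (lead z y) \<le> ennreal (\<alpha> + \<gamma> * z)"
    and \<beta>: "\<And>i. i \<in> {1..n-1} \<Longrightarrow> 0 \<le> \<beta> i \<and> \<beta> i \<le> \<alpha>" and "0 \<le> \<alpha>" "0 \<le> \<gamma>"
  shows "J y f \<le> ennreal (rate y * \<alpha> - (\<Sum>i\<in>{1..n-1}. y i * \<beta> i) / 2 + \<gamma>)"
proof -
  have "J y f \<le> (\<Sum>i\<in>{1..n-1}. ennreal (y i) * (\<integral>\<^sup>+u. indicator {0..1} u * ennreal (\<alpha> - \<beta> i * u) \<partial>lborel))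
         + (\<integral>\<^sup>+z. ennreal (\<alpha> + \<gamma> * z) \<partial>\<theta>)"
    unfolding jump_op_hop
  proof (intro add_mono sum_mono mult_left_mono)
    show "(\<integral>\<^sup>+z. f (lead z y) \<partial>\<theta>) \<le> (\<integral>\<^sup>+z. ennreal (\<alpha> + \<gamma> * z) \<partial>\<theta>)"
      using AE_theta_pos by (intro nn_integral_mono_AE) (auto elim!: eventually_mono intro: ld)
  qed (auto intro!: nn_integral_mono hp simp: indicator_def)
  also have "\<dots> = (\<Sum>i\<in>{1..n-1}. ennreal (y i * (\<alpha> - \<beta> i / 2))) + ennreal (\<alpha> + \<gamma>)"
  proof (intro arg_cong2[where f="(+)"] sum.cong refl nn_integral_affine_theta assms)
    fix i assume i: "i \<in> {1..n-1}"
    show "ennreal (y i) * (\<integral>\<^sup>+u. indicator {0..1} u * ennreal (\<alpha> - \<beta> i * u) \<partial>lborel) = ennreal (y i * (\<alpha> - \<beta> i / 2))"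
      using \<beta>[OF i] gap_space_nonneg[OF y i] by (subst nn_integral_affine_unit) (auto simp: ennreal_mult)
  qed
  also have "\<dots> = ennreal ((\<Sum>i\<in>{1..n-1}. y i * (\<alpha> - \<beta> i / 2)) + (\<alpha> + \<gamma>))"
  proof -
    have "0 \<le> y i * (\<alpha> - \<beta> i / 2)" if "i \<in> {1..n-1}" for i
      using \<beta>[OF that] gap_space_nonneg[OF y that] by auto
    moreover from this have "0 \<le> (\<Sum>i\<in>{1..n-1}. y i * (\<alpha> - \<beta> i / 2))"
      by (rule sum_nonneg)
    ultimately show ?thesis using assms(5,6) by (subst sum_ennreal) auto
  qed
  also have "(\<Sum>i\<in>{1..n-1}. y i * (\<alpha> - \<beta> i / 2)) + (\<alpha> + \<gamma>) = rate y * \<alpha> - (\<Sum>i\<in>{1..n-1}. y i * \<beta> i) / 2 + \<gamma>"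
    by (simp add: total_rate_def algebra_simps sum_distrib_left sum_subtractf sum_divide_distrib)
  finally show ?thesis .
qed

lemma jump_op_one:
  assumes "y \<in> G"
  shows "J y (\<lambda>_. 1) = ennreal (rate y)"
proof -
  interpret prob_space \<theta> by (rule theta_prob)
  have "J y (\<lambda>_. 1) = (\<Sum>i\<in>{1..n-1}. ennreal (y i)) + 1"
    unfolding jump_op_hop by (simp add: emeasure_space_1)
  also have "\<dots> = ennreal (rate y)"
    using gap_space_nonneg[OF assms] sum_nonneg[of "{1..n-1}" y]
    by (subst sum_ennreal) (auto simp: total_rate_def add.commute)
  finally show ?thesis .
qed

end

subsection \<open>Duhamel operator\<close>

context follow_the_leader begin

text \<open>Here \<open>s\<close> is the time of the first jump, and \<open>\<phi>\<close> is
  applied with the time that is left. As \<open>J\<close> already carries the jump rates, the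
  density needs no factor \<open>rate y\<close>.\<close>

definition T :: "(real \<Rightarrow> (nat \<Rightarrow> real) \<Rightarrow> ennreal) \<Rightarrow> real \<Rightarrow> (nat \<Rightarrow> real) \<Rightarrow> ennreal" where
  "T \<phi> t y = (\<integral>\<^sup>+s. indicator {0..t} s * ennreal (exp (- rate y * s)) * J y (\<phi> (t - s)) \<partial>lborel)"

definition stay :: "((nat \<Rightarrow> real) \<Rightarrow> ennreal) \<Rightarrow> real \<Rightarrow> (nat \<Rightarrow> real) \<Rightarrow> ennreal" where
  "stay f t y = ennreal (exp (- rate y * t)) * f y"

lemma ptrans_k_eq: "ptrans_k n \<theta> k t y A = (T ^^ k) (stay (indicator A)) t y"
  by (induction k arbitrary: t y) (simp_all add: T_def stay_def)

section \<open>Joint measurability of the Duhamel iterates\<close>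

lemma measurable_uncurry3:
  assumes "(\<lambda>(w,t,y). \<Phi> w t y) \<in> measurable (N \<Otimes>\<^sub>M A \<Otimes>\<^sub>M B) K"
    and [measurable]: "f \<in> measurable L N" "g \<in> measurable L A" "h \<in> measurable L B"
  shows "(\<lambda>x. \<Phi> (f x) (g x) (h x)) \<in> measurable L K"
  using measurable_compose[OF _ assms(1), of "\<lambda>x. (f x, g x, h x)" L] by simp

lemma measurable_T:
  assumes [measurable]: "(\<lambda>(w,t,y). \<Phi> w t y) \<in> borel_measurable (N \<Otimes>\<^sub>M borel \<Otimes>\<^sub>M S)"
  shows "(\<lambda>(w,t,y). T (\<Phi> w) t y) \<in> borel_measurable (N \<Otimes>\<^sub>M borel \<Otimes>\<^sub>M S)"
proof -
  have [measurable]: "(\<lambda>p. J (snd (snd (fst p))) (\<Phi> (fst (fst p)) (fst (snd (fst p)) - snd p)))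
      \<in> borel_measurable ((N \<Otimes>\<^sub>M borel \<Otimes>\<^sub>M S) \<Otimes>\<^sub>M lborel)"
    unfolding case_prod_beta'
    by (rule measurable_jump_op, unfold case_prod_beta', rule measurable_uncurry3[OF assms]; measurable)
  show ?thesis unfolding T_def indicator_def atLeastAtMost_iff by measurable
qed

lemma measurable_T_pow:
  assumes "(\<lambda>(w,t,y). \<Phi> w t y) \<in> borel_measurable (N \<Otimes>\<^sub>M borel \<Otimes>\<^sub>M S)"
  shows "(\<lambda>(w,t,y). (T ^^ k) (\<Phi> w) t y) \<in> borel_measurable (N \<Otimes>\<^sub>M borel \<Otimes>\<^sub>M S)"
  by (induction k) (simp_all add: assms measurable_T)

lemma measurable_T_pow' [measurable]:
  assumes [measurable]: "case_prod \<phi> \<in> borel_measurable (borel \<Otimes>\<^sub>M S)"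
  shows "case_prod ((T ^^ k) \<phi>) \<in> borel_measurable (borel \<Otimes>\<^sub>M S)"
proof -
  have "(\<lambda>(w::real,t,y). \<phi> t y) \<in> borel_measurable (borel \<Otimes>\<^sub>M borel \<Otimes>\<^sub>M S)"
    by measurable
  from measurable_uncurry3[OF measurable_T_pow[OF this], of "\<lambda>_. 0" _ fst snd] show ?thesis
    by (simp add: case_prod_beta')
qed

lemma measurable_stay [measurable]:
  assumes [measurable]: "f \<in> borel_measurable S"
  shows "case_prod (stay f) \<in> borel_measurable (borel \<Otimes>\<^sub>M S)"
  unfolding stay_def by measurable

lemma measurable_stay_param:
  assumes [measurable]: "(\<lambda>(w,y). F w y) \<in> borel_measurable (N \<Otimes>\<^sub>M S)"
  shows "(\<lambda>(w,t,y). stay (F w) t y) \<in> borel_measurable (N \<Otimes>\<^sub>M borel \<Otimes>\<^sub>M S)"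
  unfolding stay_def by measurable

section \<open>Monotonicity and congruence\<close>

lemma T_mono:
  assumes "y \<in> G" "\<And>s z. 0 \<le> s \<Longrightarrow> s \<le> t \<Longrightarrow> z \<in> G \<Longrightarrow> \<phi> s z \<le> \<psi> s z"
  shows "T \<phi> t y \<le> T \<psi> t y"
  unfolding T_def using assms
  by (intro nn_integral_mono) (auto simp: indicator_def intro!: mult_left_mono jump_op_mono)

lemma T_pow_mono:
  assumes "y \<in> G" "0 \<le> t" "\<And>s z. 0 \<le> s \<Longrightarrow> s \<le> t \<Longrightarrow> z \<in> G \<Longrightarrow> \<phi> s z \<le> \<psi> s z"
  shows "(T ^^ k) \<phi> t y \<le> (T ^^ k) \<psi> t y"
  using assms
proof (induction k arbitrary: t y)
  case (Suc k)
  show ?case using Suc.prems by (auto intro!: T_mono Suc.IH)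
qed auto

lemma T_pow_cong:
  assumes "y \<in> G" "0 \<le> t" "\<And>s z. 0 \<le> s \<Longrightarrow> s \<le> t \<Longrightarrow> z \<in> G \<Longrightarrow> \<phi> s z = \<psi> s z"
  shows "(T ^^ k) \<phi> t y = (T ^^ k) \<psi> t y"
  using T_pow_mono[OF assms(1,2), of \<phi> \<psi>] T_pow_mono[OF assms(1,2), of \<psi> \<phi>] assms(3)
  by (intro antisym) auto

text \<open>Jumps preserve \<open>space S\<close> for all real \<open>u\<close> and
  \<open>z\<close>, so identities such as linearity and the semigroup law can be proved there
  without sign conditions.\<close>

lemma T_cong_space:
  assumes "y \<in> space S" "\<And>s z. 0 \<le> s \<Longrightarrow> s \<le> t \<Longrightarrow> z \<in> space S \<Longrightarrow> \<phi> s z = \<psi> s z"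
  shows "T \<phi> t y = T \<psi> t y"
  unfolding T_def
proof (intro nn_integral_cong)
  fix s
  have "J y (\<phi> (t - s)) = J y (\<psi> (t - s))" if "0 \<le> s" "s \<le> t"
    unfolding jump_op_hop using assms that
    by (intro arg_cong2[where f="(+)"] sum.cong refl arg_cong2[where f="(*)"] nn_integral_cong)
      (simp_all add: hop_space lead_space)
  then show "indicator {0..t} s * ennreal (exp (- rate y * s)) * J y (\<phi> (t - s)) =
    indicator {0..t} s * ennreal (exp (- rate y * s)) * J y (\<psi> (t - s))"
    by (simp add: indicator_def)
qed

lemma T_pow_cong_space:
  assumes "y \<in> space S" "\<And>s z. z \<in> space S \<Longrightarrow> \<phi> s z = \<psi> s z"
  shows "(T ^^ k) \<phi> t y = (T ^^ k) \<psi> t y"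
  using assms by (induction k arbitrary: t y) (auto intro: T_cong_space)

section \<open>Tonelli and linearity for the Duhamel operator\<close>

lemma measurable_jump_op_time [measurable]:
  fixes t :: real
  assumes [measurable]: "case_prod \<phi> \<in> borel_measurable (borel \<Otimes>\<^sub>M S)" "y \<in> space S"
  shows "(\<lambda>s. J y (\<phi> (t - s))) \<in> borel_measurable borel"
  by (rule measurable_jump_op; measurable)

lemma T_nn_integral:
  assumes [measurable]: "(\<lambda>(w,t,y). \<Phi> w t y) \<in> borel_measurable (N \<Otimes>\<^sub>M borel \<Otimes>\<^sub>M S)"
    and N: "sigma_finite_measure N" and y[measurable]: "y \<in> space S"
  shows "T (\<lambda>t z. \<integral>\<^sup>+w. \<Phi> w t z \<partial>N) t y = (\<integral>\<^sup>+w. T (\<Phi> w) t y \<partial>N)"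
proof -
  interpret N: sigma_finite_measure N by (rule N)
  interpret N1: pair_sigma_finite N "lborel :: real measure" ..
  have [measurable]: "(\<lambda>p. J y (\<Phi> (fst p) (t - snd p))) \<in> borel_measurable (N \<Otimes>\<^sub>M lborel)"
    by (rule measurable_jump_op, unfold case_prod_beta', rule measurable_uncurry3[OF assms(1)]; measurable)
  have "T (\<lambda>t z. \<integral>\<^sup>+w. \<Phi> w t z \<partial>N) t y =
      (\<integral>\<^sup>+s. (\<integral>\<^sup>+w. indicator {0..t} s * ennreal (exp (- rate y * s)) * J y (\<Phi> w (t - s)) \<partial>N) \<partial>lborel)"
    unfolding T_def
  proof (intro nn_integral_cong)
    fix s
    have "J y (\<lambda>z. \<integral>\<^sup>+w. \<Phi> w (t - s) z \<partial>N) = (\<integral>\<^sup>+w. J y (\<Phi> w (t - s)) \<partial>N)"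
      by (rule jump_op_nn_integral[OF _ y N], unfold case_prod_beta', rule measurable_uncurry3[OF assms(1)]; measurable)
    moreover have "(\<lambda>w. J y (\<Phi> w (t - s))) \<in> borel_measurable N"
      by (rule measurable_jump_op, unfold case_prod_beta', rule measurable_uncurry3[OF assms(1)]; measurable)
    ultimately show "indicator {0..t} s * ennreal (exp (- rate y * s)) * J y (\<lambda>z. \<integral>\<^sup>+w. \<Phi> w (t - s) z \<partial>N) =
       (\<integral>\<^sup>+w. indicator {0..t} s * ennreal (exp (- rate y * s)) * J y (\<Phi> w (t - s)) \<partial>N)"
      by (simp add: nn_integral_cmult)
  qed
  also have "\<dots> = (\<integral>\<^sup>+w. T (\<Phi> w) t y \<partial>N)"
    unfolding T_def by (rule N1.Fubini') measurable
  finally show ?thesis .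
qed

lemma T_pow_nn_integral:
  assumes m: "(\<lambda>(w,t,y). \<Phi> w t y) \<in> borel_measurable (N \<Otimes>\<^sub>M borel \<Otimes>\<^sub>M S)"
    and N: "sigma_finite_measure N" and y: "y \<in> space S"
  shows "(T ^^ k) (\<lambda>t z. \<integral>\<^sup>+w. \<Phi> w t z \<partial>N) t y = (\<integral>\<^sup>+w. (T ^^ k) (\<Phi> w) t y \<partial>N)"
  using y
proof (induction k arbitrary: t y)
  case (Suc k)
  have "(T ^^ Suc k) (\<lambda>t z. \<integral>\<^sup>+w. \<Phi> w t z \<partial>N) t y = T (\<lambda>t z. \<integral>\<^sup>+w. (T ^^ k) (\<Phi> w) t z \<partial>N) t y"
    unfolding funpow.simps comp_def using Suc by (intro T_cong_space) simp_all
  also have "\<dots> = (\<integral>\<^sup>+w. (T ^^ Suc k) (\<Phi> w) t y \<partial>N)"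
    using Suc.prems N measurable_T_pow[OF m] by (simp add: T_nn_integral)
  finally show ?case .
qed simp

lemma measurable_count_space_param:
  assumes "\<And>i. case_prod (\<Phi> i) \<in> borel_measurable (borel \<Otimes>\<^sub>M S)"
  shows "(\<lambda>(i,t,y). \<Phi> i t y) \<in> borel_measurable (count_space (UNIV :: 'i :: countable set) \<Otimes>\<^sub>M borel \<Otimes>\<^sub>M S)"
  by (rule measurable_pair_measure_countable1[OF countableI_type]) (use assms in simp)

lemma T_pow_add:
  assumes "case_prod \<phi> \<in> borel_measurable (borel \<Otimes>\<^sub>M S)" "case_prod \<psi> \<in> borel_measurable (borel \<Otimes>\<^sub>M S)" "y \<in> space S"
  shows "(T ^^ k) (\<lambda>t z. \<phi> t z + \<psi> t z) t y = (T ^^ k) \<phi> t y + (T ^^ k) \<psi> t y"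
proof -
  \<comment> \<open>The sum of two functions is an integral over a two-point counting measure, so
    additivity is an instance of Tonelli.\<close>
  define \<Phi> where "\<Phi> b = (if b then \<phi> else \<psi>)" for b
  have "(T ^^ k) (\<lambda>t z. \<integral>\<^sup>+b. \<Phi> b t z \<partial>count_space UNIV) t y = (\<integral>\<^sup>+b. (T ^^ k) (\<Phi> b) t y \<partial>count_space UNIV)"
    using assms by (intro T_pow_nn_integral measurable_count_space_param sigma_finite_measure_count_space)
      (auto simp: \<Phi>_def)
  then show ?thesis
    by (simp add: nn_integral_count_space_finite UNIV_bool \<Phi>_def add.commute)
qed

lemma T_add:
  assumes "case_prod \<phi> \<in> borel_measurable (borel \<Otimes>\<^sub>M S)" "case_prod \<psi> \<in> borel_measurable (borel \<Otimes>\<^sub>M S)" "y \<in> space S"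
  shows "T (\<lambda>t z. \<phi> t z + \<psi> t z) t y = T \<phi> t y + T \<psi> t y"
  using T_pow_add[OF assms, of "Suc 0"] by simp

lemma T_cmult:
  assumes [measurable]: "case_prod \<phi> \<in> borel_measurable (borel \<Otimes>\<^sub>M S)" and [measurable]: "y \<in> space S"
  shows "T (\<lambda>t z. c * \<phi> t z) t y = c * T \<phi> t y"
proof -
  have "J y (\<lambda>z. c * \<phi> s z) = c * J y (\<phi> s)" for s
    by (rule jump_op_cmult; measurable)
  then show ?thesis by (simp add: T_def mult.left_commute[of _ c] nn_integral_cmult)
qed

lemma T_pow_cmult:
  assumes [measurable]: "case_prod \<phi> \<in> borel_measurable (borel \<Otimes>\<^sub>M S)" and y: "y \<in> space S"
  shows "(T ^^ k) (\<lambda>t z. c * \<phi> t z) t y = c * (T ^^ k) \<phi> t y"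
  using y
proof (induction k arbitrary: t y)
  case (Suc k)
  have "(T ^^ Suc k) (\<lambda>t z. c * \<phi> t z) t y = T (\<lambda>t z. c * (T ^^ k) \<phi> t z) t y"
    unfolding funpow.simps comp_def using Suc by (intro T_cong_space) simp_all
  then show ?case using Suc.prems by (simp add: T_cmult)
qed simp

lemma T_sum:
  assumes "finite K" "\<And>j. j \<in> K \<Longrightarrow> case_prod (\<Phi> j) \<in> borel_measurable (borel \<Otimes>\<^sub>M S)" and y: "y \<in> space S"
  shows "T (\<lambda>t y. \<Sum>j\<in>K. \<Phi> j t y) t y = (\<Sum>j\<in>K. T (\<Phi> j) t y)"
  using assms(1,2)
proof (induction K rule: finite_induct)
  case empty
  \<comment> \<open>Zero is written as 0 times 1 so that homogeneity makes its image vanish.\<close>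
  have "T (\<lambda>t y. 0 * 1) t y = 0"
    using y by (subst T_cmult) auto
  then show ?case by simp
next
  case (insert a K)
  have "case_prod (\<lambda>t y. \<Sum>j\<in>K. \<Phi> j t y) \<in> borel_measurable (borel \<Otimes>\<^sub>M S)"
    using insert.prems unfolding case_prod_beta' by (intro borel_measurable_sum) auto
  with insert show ?case using y by (simp add: T_add)
qed

text \<open>The partial sums arise from 0 by iterating the monotone map u \<mapsto> \<phi> + T u, so
  none of them can pass a supersolution. This is the minimality of Feller's construction.\<close>

lemma T_pow_sum_le_supersolution:
  assumes [measurable]: "case_prod \<phi> \<in> borel_measurable (borel \<Otimes>\<^sub>M S)"
    and super: "\<And>t y. 0 \<le> t \<Longrightarrow> y \<in> G \<Longrightarrow> \<phi> t y + T u t y \<le> u t y"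
    and "0 \<le> t" "y \<in> G"
  shows "(\<Sum>j<k. (T ^^ j) \<phi> t y) \<le> u t y"
  using assms(3,4)
proof (induction k arbitrary: t y)
  case (Suc k)
  have T_sum: "T (\<lambda>t y. \<Sum>j<k. (T ^^ j) \<phi> t y) t y = (\<Sum>j<k. (T ^^ Suc j) \<phi> t y)"
    using Suc.prems gap_space_sub by (subst T_sum) auto
  have "(\<Sum>j<Suc k. (T ^^ j) \<phi> t y) = \<phi> t y + T (\<lambda>t y. \<Sum>j<k. (T ^^ j) \<phi> t y) t y"
    unfolding T_sum by (subst sum.lessThan_Suc_shift) simp
  also have "\<dots> \<le> \<phi> t y + T u t y"
    using Suc by (intro add_mono T_mono) auto
  also have "\<dots> \<le> u t y" by (rule super) fact+
  finally show ?case .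
qed simp

text \<open>A differential inequality at a fixed \<open>y\<close> is integrated over the first jump
  time: \<open>exp (- rate y * s) * v (t - s)\<close> decreases in \<open>s\<close> at a rate that
  bounds the integrand of \<open>T\<close>. While \<open>v\<close> is the time profile at
  \<open>y\<close> alone, \<open>w\<close> is evaluated after a jump, so space enters only through
  \<open>J\<close>.\<close>

lemma T_duhamel:
  fixes v v' :: "real \<Rightarrow> real"
  assumes v: "\<And>r. 0 \<le> r \<Longrightarrow> (v has_real_derivative v' r) (at r)"
    and [measurable]: "v \<in> borel_measurable borel" "v' \<in> borel_measurable borel"
    and nn: "\<And>r. 0 \<le> r \<Longrightarrow> 0 \<le> v r" "\<And>r. 0 \<le> r \<Longrightarrow> 0 \<le> rate y * v r + v' r"
    and w: "\<And>r. 0 \<le> r \<Longrightarrow> J y (w r) \<le> ennreal (rate y * v r + v' r)"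
    and t: "0 \<le> t"
  shows "ennreal (exp (- rate y * t) * v 0) + T w t y \<le> ennreal (v t)"
proof -
  let ?g = "\<lambda>s. exp (- rate y * s) * (rate y * v (t - s) + v' (t - s))"
  let ?F = "\<lambda>s. - exp (- rate y * s) * v (t - s)"
  have dF: "(?F has_real_derivative ?g s) (at s)" if "s \<le> t" for s
  proof -
    have "((\<lambda>s. t - s) has_real_derivative - 1) (at s)"
      by (rule derivative_eq_intros refl | simp add: mult.commute)+
    from DERIV_chain'[OF this v[of "t - s"]] that
    have "((\<lambda>s. v (t - s)) has_real_derivative - v' (t - s)) (at s)" by simp
    moreover have "((\<lambda>s. - exp (- rate y * s)) has_real_derivative exp (- rate y * s) * rate y) (at s)"
      by (rule derivative_eq_intros refl | simp add: mult.commute)+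
    ultimately have "(?F has_real_derivative exp (- rate y * s) * rate y * v (t - s) + - v' (t - s) * - exp (- rate y * s)) (at s)"
      by (intro DERIV_mult)
    then show ?thesis by (simp add: algebra_simps)
  qed
  have "T w t y \<le> (\<integral>\<^sup>+s. ennreal (?g s) * indicator {0..t} s \<partial>lborel)"
    unfolding T_def
  proof (intro nn_integral_mono)
    fix s
    show "indicator {0..t} s * ennreal (exp (- rate y * s)) * J y (w (t - s)) \<le> ennreal (?g s) * indicator {0..t} s"
      using w[of "t - s"] by (auto simp: indicator_def ennreal_mult' intro!: mult_left_mono)
  qed
  also have "\<dots> = ennreal (?F t - ?F 0)"
  proof (rule nn_integral_FTC_Icc)
    show "?g \<in> borel_measurable borel" by measurable
    fix s assume s: "s \<in> {0..t}"
    show "(?F has_real_derivative ?g s) (at s)"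
      using s by (intro dF) auto
    show "0 \<le> ?g s" using s nn(2)[of "t - s"] by auto
  qed (rule t)
  finally have "ennreal (exp (- rate y * t) * v 0) + T w t y
      \<le> ennreal (exp (- rate y * t) * v 0) + ennreal (?F t - ?F 0)"
    by (rule add_left_mono)
  also have "\<dots> = ennreal (v t)"
  \<comment> \<open>\<open>ennreal\<close> would truncate a negative difference; that case is void
    because \<open>?F\<close> is nondecreasing.\<close>
  proof (cases "?F t - ?F 0 \<ge> 0")
    case True then show ?thesis using nn(1)[of 0] by (subst ennreal_plus[symmetric]) auto
  next
    case False
    have "?F 0 \<le> ?F t"
    proof (rule DERIV_nonneg_imp_nondecreasing[OF t])
      fix s assume s: "0 \<le> s" "s \<le> t"
      have "(?F has_real_derivative ?g s) (at s)"
        using s by (intro dF)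
      then show "\<exists>y. (?F has_real_derivative y) (at s) \<and> 0 \<le> y"
        using s nn(2)[of "t - s"] by force
    qed
    then show ?thesis using False by auto
  qed
  finally show ?thesis .
qed

end

subsection \<open>Transition semigroup and non-explosion\<close>

text \<open>Both sides sum over all pairs; extending the inner sum by zero makes Tonelli for
  counting measures applicable. In the semigroup law the pair is the number of jumps before and
  after an intermediate time.\<close>

lemma suminf_ennreal_convolution:
  fixes b :: "nat \<Rightarrow> nat \<Rightarrow> ennreal"
  shows "(\<Sum>k. \<Sum>j\<le>k. b j (k - j)) = (\<Sum>j. \<Sum>i. b j i)"
proof -
  let ?c = "\<lambda>k j. if j \<le> k then b j (k - j) else 0"
  interpret pair_sigma_finite "count_space (UNIV :: nat set)" "count_space (UNIV :: nat set)"
    by (intro pair_sigma_finite.intro sigma_finite_measure_count_space)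
  have "(\<Sum>j\<le>k. b j (k - j)) = (\<Sum>j. ?c k j)" for k
    by (subst suminf_finite[of "{..k}"]) auto
  then have "(\<Sum>k. \<Sum>j\<le>k. b j (k - j)) = (\<Sum>k. \<Sum>j. ?c k j)" by simp
  also have "\<dots> = (\<Sum>j. \<Sum>k. ?c k j)"
    unfolding nn_integral_count_space_nat[symmetric]
    by (rule Fubini') (auto intro!: measurable_pair_measure_countable1)
  also have "\<dots> = (\<Sum>j. \<Sum>i. b j i)"
  proof (rule suminf_cong)
    fix j
    show "(\<Sum>k. ?c k j) = (\<Sum>i. b j i)"
      by (subst suminf_offset[where i=j]) (auto intro: summableI)
  qed
  finally show ?thesis .
qed

context follow_the_leader begin

text \<open>It acts on functions rather than on sets so that \<open>P t (P s f)\<close> makes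
  sense.\<close>

definition P :: "real \<Rightarrow> ((nat \<Rightarrow> real) \<Rightarrow> ennreal) \<Rightarrow> (nat \<Rightarrow> real) \<Rightarrow> ennreal" where
  "P t f y = (\<Sum>k. (T ^^ k) (stay f) t y)"

lemma suminf_ptrans_k: "(\<Sum>k. ptrans_k n \<theta> k t y A) = P t (indicator A) y"
  by (simp add: ptrans_k_eq P_def)

lemma measurable_P_joint:
  assumes [measurable]: "f \<in> borel_measurable S"
  shows "(\<lambda>(t,y). P t f y) \<in> borel_measurable (borel \<Otimes>\<^sub>M S)"
proof -
  have [measurable]: "case_prod ((T ^^ k) (stay f)) \<in> borel_measurable (borel \<Otimes>\<^sub>M S)" for k
    by (intro measurable_T_pow' measurable_stay assms)
  show ?thesis unfolding P_def by measurable
qed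

lemma measurable_P [measurable]:
  assumes [measurable]: "f \<in> borel_measurable S"
  shows "P t f \<in> borel_measurable S"
  using measurable_compose[OF _ measurable_P_joint[OF assms], of "\<lambda>y. (t, y)"] by simp

lemma P_mono:
  assumes "y \<in> G" "0 \<le> t" "\<And>z. z \<in> G \<Longrightarrow> f z \<le> g z"
  shows "P t f y \<le> P t g y"
  unfolding P_def using assms
  by (intro suminf_le T_pow_mono) (auto simp: stay_def intro!: mult_left_mono summableI)

lemma P_cong:
  assumes "y \<in> G" "0 \<le> t" "\<And>z. z \<in> G \<Longrightarrow> f z = g z"
  shows "P t f y = P t g y"
  using P_mono[OF assms(1,2), of f g] P_mono[OF assms(1,2), of g f] assms(3)
  by (intro antisym) auto

lemma P_nn_integral:
  assumes F[measurable]: "(\<lambda>(w,y). F w y) \<in> borel_measurable (N \<Otimes>\<^sub>M S)"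
    and N: "sigma_finite_measure N" and y: "y \<in> space S"
  shows "P t (\<lambda>z. \<integral>\<^sup>+w. F w z \<partial>N) y = (\<integral>\<^sup>+w. P t (F w) y \<partial>N)"
proof -
  have "(T ^^ k) (stay (\<lambda>z. \<integral>\<^sup>+w. F w z \<partial>N)) t y = (\<integral>\<^sup>+w. (T ^^ k) (stay (F w)) t y \<partial>N)" for k
  proof -
    have "(T ^^ k) (stay (\<lambda>z. \<integral>\<^sup>+w. F w z \<partial>N)) t y = (T ^^ k) (\<lambda>t z. \<integral>\<^sup>+w. stay (F w) t z \<partial>N) t y"
      using y by (rule T_pow_cong_space) (auto simp: stay_def nn_integral_cmult)
    then show ?thesis
      using T_pow_nn_integral[OF measurable_stay_param[OF F] N y] by simp
  qed
  moreover have "(\<lambda>w. (T ^^ k) (stay (F w)) t y) \<in> borel_measurable N" for k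
    by (rule measurable_uncurry3[OF measurable_T_pow[OF measurable_stay_param[OF F]]]) (use y in auto)
  ultimately show ?thesis
    unfolding P_def by (simp add: nn_integral_suminf)
qed

lemma P_suminf:
  assumes "\<And>i::nat. F i \<in> borel_measurable S" and y: "y \<in> space S"
  shows "P t (\<lambda>z. \<Sum>i. F i z) y = (\<Sum>i. P t (F i) y)"
  unfolding nn_integral_count_space_nat[symmetric]
  by (rule P_nn_integral[OF measurable_pair_measure_countable1 sigma_finite_measure_count_space y])
    (use assms in auto)

lemma P_add:
  assumes "f \<in> borel_measurable S" "g \<in> borel_measurable S" and y: "y \<in> space S"
  shows "P t (\<lambda>z. f z + g z) y = P t f y + P t g y"
proof -
  define F where "F b = (if b then f else g)" for b
  have "P t (\<lambda>z. \<integral>\<^sup>+b. F b z \<partial>count_space UNIV) y = (\<integral>\<^sup>+b. P t (F b) y \<partial>count_space UNIV)"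
    by (rule P_nn_integral[OF measurable_pair_measure_countable1 sigma_finite_measure_count_space y])
      (use assms in \<open>auto simp: F_def\<close>)
  then show ?thesis
    by (simp add: nn_integral_count_space_finite UNIV_bool F_def add.commute)
qed

lemma P_cmult:
  assumes [measurable]: "f \<in> borel_measurable S" and y: "y \<in> space S"
  shows "P t (\<lambda>z. c * f z) y = c * P t f y"
proof -
  have "(T ^^ k) (stay (\<lambda>z. c * f z)) t y = c * (T ^^ k) (stay f) t y" for k
  proof -
    have "(T ^^ k) (stay (\<lambda>z. c * f z)) t y = (T ^^ k) (\<lambda>t z. c * stay f t z) t y"
      using y by (rule T_pow_cong_space) (simp add: stay_def mult.left_commute)
    then show ?thesis using y by (simp add: T_pow_cmult)
  qed
  then show ?thesis by (simp add: P_def)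
qed

section \<open>Linear functionals of the gaps along jumps\<close>

lemma sum_fun_upd:
  fixes c y :: "nat \<Rightarrow> real"
  assumes "finite I" "i \<in> I"
  shows "(\<Sum>j\<in>I. c j * (y(i := x)) j) = (\<Sum>j\<in>I. c j * y j) + c i * (x - y i)"
proof -
  have "(\<Sum>j\<in>I - {i}. c j * (y(i := x)) j) = (\<Sum>j\<in>I - {i}. c j * y j)"
    by (intro sum.cong) auto
  then show ?thesis using assms by (simp add: sum.remove[of I i] algebra_simps)
qed

text \<open>A hop moves the length \<open>y i * u\<close> from the coefficient of gap
  \<open>i\<close> to that of the next gap, or out of the system at the last gap. Constant
  coefficients give the rate, the coefficients n - i the Lyapunov function.\<close>

lemma sum_hop:
  assumes "i \<in> {1..n-1}"
  shows "(\<Sum>j\<in>{1..n-1}. c j * hop i u y j)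
    = (\<Sum>j\<in>{1..n-1}. c j * y j) - (c i - (if i = n - 1 then 0 else c (Suc i))) * (y i * u)"
proof (cases "i = n - 1")
  case True
  then show ?thesis using assms sum_fun_upd[of "{1..n-1}" i c y "y i - y i * u"]
    by (simp add: hop_def del: fun_upd_apply)
next
  case False
  then have "Suc i \<in> {1..n-1}" using assms by auto
  moreover define y' where "y' = y(i := y i - y i * u)"
  ultimately have "(\<Sum>j\<in>{1..n-1}. c j * (y'(Suc i := y (Suc i) + y i * u)) j)
      = (\<Sum>j\<in>{1..n-1}. c j * y' j) + c (Suc i) * (y i * u)"
    by (subst sum_fun_upd) (auto simp: y'_def)
  also have "(\<Sum>j\<in>{1..n-1}. c j * y' j) = (\<Sum>j\<in>{1..n-1}. c j * y j) - c i * (y i * u)"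
    unfolding y'_def using assms by (subst sum_fun_upd) auto
  finally show ?thesis using False unfolding hop_def if_not_P[OF False] y'_def
    by (simp add: algebra_simps del: fun_upd_apply)
qed

lemma sum_lead:
  "(\<Sum>j\<in>{1..n-1}. c j * lead z y j) = (\<Sum>j\<in>{1..n-1}. c j * y j) + c 1 * z"
  unfolding lead_def using n2 by (subst sum_fun_upd) auto

lemma rate_hop_le:
  assumes "y \<in> G" "i \<in> {1..n-1}" "0 \<le> u"
  shows "rate (hop i u y) \<le> rate y"
  using sum_hop[OF assms(2), of "\<lambda>_. 1" u y] gap_space_nonneg[OF assms(1,2)] assms(3)
  by (auto simp: total_rate_def split: if_splits)

lemma rate_lead: "rate (lead z y) = rate y + z"
  using sum_lead[of "\<lambda>_. 1" z y] by (simp add: total_rate_def)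

text \<open>By time \<open>t\<close> there is either no jump or a first one. As the total jump mass
  is \<open>rate y\<close>, the constant 1 solves the backward equation with equality.\<close>

lemma T_one:
  assumes "y \<in> G" "0 \<le> t"
  shows "stay (\<lambda>_. 1) t y + T (\<lambda>_ _. 1) t y = 1"
proof -
  have "T (\<lambda>_ _. 1) t y = (\<integral>\<^sup>+s. ennreal (exp (- rate y * s) * rate y) * indicator {0..t} s \<partial>lborel)"
    unfolding T_def jump_op_one[OF assms(1)] using rate_ge_1[OF assms(1)]
    by (intro nn_integral_cong) (auto simp: indicator_def ennreal_mult)
  also have "\<dots> = ennreal (- exp (- rate y * t) - (- exp (- rate y * 0)))"
  proof (rule nn_integral_FTC_Icc)
    fix s
    show "((\<lambda>s. - exp (- rate y * s)) has_real_derivative exp (- rate y * s) * rate y) (at s)"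
      by (rule derivative_eq_intros refl | simp)+
    show "0 \<le> exp (- rate y * s) * rate y" using rate_ge_1[OF assms(1)] by simp
  qed (use assms in \<open>auto simp: measurable_const\<close>)
  finally show ?thesis
    using rate_ge_1[OF assms(1)] assms(2) by (simp add: stay_def flip: ennreal_plus)
qed

text \<open>\<open>(T ^^ j)\<close> of the constant 1 is the probability of at least
  \<open>j\<close> jumps by time \<open>t\<close>, so this controls the mean number of
  jumps.\<close>

lemma T_pow_one_bound:
  assumes "y \<in> G" "0 \<le> t"
  shows "(\<Sum>j<k. (T ^^ j) (\<lambda>_ _. 1) t y) \<le> ennreal (1 + exp (2 * t) * rate y)"
proof (rule T_pow_sum_le_supersolution[where u="\<lambda>t y. ennreal (1 + exp (2 * t) * rate y)"])
  fix t :: real and y assume t: "0 \<le> t" and y: "y \<in> G"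
  let ?l = "rate y"
  have l: "1 \<le> ?l" by (rule rate_ge_1[OF y])
  have "ennreal (exp (- ?l * t) * (exp (2 * 0) * ?l)) + T (\<lambda>t y. ennreal (1 + exp (2 * t) * rate y)) t y
      \<le> ennreal (exp (2 * t) * ?l)"
  proof (rule T_duhamel[where v'="\<lambda>r. 2 * exp (2 * r) * ?l"])
    fix r :: real assume r: "0 \<le> r"
    show "((\<lambda>r. exp (2 * r) * ?l) has_real_derivative 2 * exp (2 * r) * ?l) (at r)"
      by (rule derivative_eq_intros refl | simp)+
    have "J y (\<lambda>y. ennreal (1 + exp (2 * r) * rate y))
        \<le> ennreal (?l * (1 + exp (2 * r) * ?l) - (\<Sum>i\<in>{1..n-1}. y i * 0) / 2 + exp (2 * r))"
      using l by (intro jump_op_affine_bound[OF y] ennreal_leI)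
        (auto simp: rate_lead distrib_left intro!: mult_left_mono rate_hop_le[OF y])
    \<comment> \<open>The factor 2 in the exponent pays for two terms, \<open>?l\<close> from the
      summand 1 and \<open>exp (2 * r)\<close> from the mean jump of the leader. Each is at most
      \<open>exp (2 * r) * ?l\<close> because \<open>?l\<close> is at least 1.\<close>
    also have "\<dots> \<le> ennreal (?l * (exp (2 * r) * ?l) + 2 * exp (2 * r) * ?l)"
    proof (rule ennreal_leI)
      have "?l * 1 \<le> ?l * exp (2 * r)" "exp (2 * r) * 1 \<le> exp (2 * r) * ?l"
        using l r by (intro mult_left_mono; simp)+
      then have "?l + exp (2 * r) \<le> ?l * exp (2 * r) + exp (2 * r) * ?l"
        by linarith
      then show "?l * (1 + exp (2 * r) * ?l) - (\<Sum>i\<in>{1..n-1}. y i * 0) / 2 + exp (2 * r)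
          \<le> ?l * (exp (2 * r) * ?l) + 2 * exp (2 * r) * ?l"
        by (simp add: algebra_simps)
    qed
    finally show "J y (\<lambda>y. ennreal (1 + exp (2 * r) * rate y))
        \<le> ennreal (?l * (exp (2 * r) * ?l) + 2 * exp (2 * r) * ?l)" .
  qed (use l t in \<open>auto intro!: borel_measurable_times\<close>)
  then have "T (\<lambda>t y. ennreal (1 + exp (2 * t) * rate y)) t y \<le> ennreal (exp (2 * t) * ?l)"
    by (rule order_trans[rotated]) simp
  then show "1 + T (\<lambda>t y. ennreal (1 + exp (2 * t) * rate y)) t y \<le> ennreal (1 + exp (2 * t) * ?l)"
    using l by (simp add: add_left_mono)
qed (use assms in auto)

text \<open>Non-explosion by telescoping: \<open>E k\<close> is the probability of at least
  \<open>k\<close> jumps and \<open>p k\<close> that of exactly \<open>k\<close>. The sum of all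
  \<open>E k\<close> is finite, so it can be cancelled and leaves \<open>E 0 = 1\<close>.\<close>

lemma P_one:
  assumes y: "y \<in> G" and t: "0 \<le> t"
  shows "P t (\<lambda>_. 1) y = 1"
proof -
  define E where "E k = (T ^^ k) (\<lambda>_ _. 1) t y" for k
  define p where "p k = (T ^^ k) (stay (\<lambda>_. 1)) t y" for k
  have step: "p k + E (Suc k) = E k" for k
  proof -
    have m: "case_prod (T (\<lambda>_ _. 1)) \<in> borel_measurable (borel \<Otimes>\<^sub>M S)"
      using measurable_T_pow'[of "\<lambda>_ _. 1" "Suc 0"] by simp
    have "E k = (T ^^ k) (\<lambda>t y. stay (\<lambda>_. 1) t y + T (\<lambda>_ _. 1) t y) t y"
      unfolding E_def by (rule T_pow_cong[OF y t]) (simp add: T_one)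
    also have "\<dots> = p k + E (Suc k)"
      unfolding p_def E_def using gap_space_sub[OF y] m
      by (subst T_pow_add) (auto simp: funpow_Suc_right simp del: funpow.simps(2))
    finally show ?thesis ..
  qed
  have "(\<Sum>k. E k) \<le> ennreal (1 + exp (2 * t) * rate y)"
    unfolding E_def by (rule suminf_le_const[OF summableI]) (rule T_pow_one_bound[OF y t])
  then have fin: "(\<Sum>k. E k) \<noteq> \<infinity>"
    using ennreal_less_top le_less_trans by (metis infinity_ennreal_def less_irrefl)
  have E0: "E 0 = 1" by (simp add: E_def)
  have tail: "(\<Sum>k. E k) = (\<Sum>k. E (Suc k)) + 1"
    using suminf_offset[of E "Suc 0"] E0 by (auto intro: summableI)
  have "(\<Sum>k. p k) + (\<Sum>k. E (Suc k)) = (\<Sum>k. E k)"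
    by (subst suminf_add) (auto intro: summableI simp: step)
  then have "(\<Sum>k. E (Suc k)) + (\<Sum>k. p k) = (\<Sum>k. E (Suc k)) + 1"
    using tail by (simp add: add.commute)
  then have "(\<Sum>k. p k) = 1"
    using fin tail by (auto simp: ennreal_add_left_cancel)
  then show ?thesis by (simp add: P_def p_def)
qed

lemma P_const:
  assumes "y \<in> G" "0 \<le> t"
  shows "P t (\<lambda>_. c) y = c"
  using P_cmult[of "\<lambda>_. 1" y t c] P_one[OF assms] gap_space_sub[OF assms(1)] by simp

end

subsection \<open>Chapman-Kolmogorov and coming down from infinity\<close>

context follow_the_leader begin

text \<open>The first jump falls before or after \<open>t\<close>. In the first case
  \<open>\<phi>\<close> has \<open>s\<close> more time units to run; in the second the exponential
  waiting time has no memory and starts afresh at \<open>t\<close>.\<close>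

lemma T_shift:
  assumes [measurable]: "case_prod \<phi> \<in> borel_measurable (borel \<Otimes>\<^sub>M S)" "y \<in> space S"
    and t: "0 \<le> t" and s: "0 \<le> s"
  shows "T \<phi> (t + s) y = T (\<lambda>r. \<phi> (r + s)) t y + stay (T \<phi> s) t y"
proof -
  let ?g = "\<lambda>r. ennreal (exp (- rate y * r)) * J y (\<phi> (t + s - r))"
  have [measurable]: "(\<lambda>r. J y (\<phi> (t + s - r))) \<in> borel_measurable borel" for t
    by measurable
  have [measurable]: "(\<lambda>r. J y (\<phi> (s - r))) \<in> borel_measurable borel"
    by measurable
  have "T \<phi> (t + s) y = (\<integral>\<^sup>+r. indicator {0..t} r * ?g r + indicator {t<..t+s} r * ?g r \<partial>lborel)"
    unfolding T_def using t s by (intro nn_integral_cong) (auto simp: indicator_def)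
  also have "\<dots> = (\<integral>\<^sup>+r. indicator {0..t} r * ?g r \<partial>lborel) + (\<integral>\<^sup>+r. indicator {t<..t+s} r * ?g r \<partial>lborel)"
    by (rule nn_integral_add; measurable)
  also have "(\<integral>\<^sup>+r. indicator {0..t} r * ?g r \<partial>lborel) = T (\<lambda>r. \<phi> (r + s)) t y"
    unfolding T_def by (intro nn_integral_cong) (simp add: algebra_simps)
  also have "(\<integral>\<^sup>+r. indicator {t<..t+s} r * ?g r \<partial>lborel) = (\<integral>\<^sup>+r. indicator {t<..t+s} (t + 1 * r) * ?g (t + 1 * r) \<partial>lborel)"
    by (subst nn_integral_real_affine[where c=1 and t=t]) auto
  also have "\<dots> = (\<integral>\<^sup>+r. ennreal (exp (- rate y * t)) * (indicator {0..s} r * ennreal (exp (- rate y * r)) * J y (\<phi> (s - r))) \<partial>lborel)"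
  proof (intro nn_integral_cong_AE)
    \<comment> \<open>After the translation one interval is open at 0 and the other closed; the
      point 0 is negligible.\<close>
    have "AE r in lborel. r \<noteq> (0::real)" by (rule AE_lborel_singleton)
    then show "AE r in lborel. indicator {t<..t+s} (t + 1 * r) * ?g (t + 1 * r)
      = ennreal (exp (- rate y * t)) * (indicator {0..s} r * ennreal (exp (- rate y * r)) * J y (\<phi> (s - r)))"
      by eventually_elim
        (auto simp: indicator_def distrib_left exp_add exp_diff exp_minus ennreal_mult[symmetric] mult.assoc[symmetric] divide_simps)
  qed
  also have "\<dots> = stay (T \<phi> s) t y"
    unfolding stay_def T_def by (rule nn_integral_cmult) measurable
  finally show ?thesis .
qed

text \<open>Of the \<open>k\<close> jumps, \<open>j\<close> occur in the first \<open>t\<close> time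
  units and k - j in the remaining \<open>s\<close>. The induction peels off the first jump, and the
  second summand of \<open>T_shift\<close> is the term j = 0.\<close>

lemma T_pow_shift:
  assumes [measurable]: "f \<in> borel_measurable S" and "y \<in> space S" "0 \<le> t" "0 \<le> s"
  shows "(T ^^ k) (stay f) (t + s) y = (\<Sum>j\<le>k. (T ^^ j) (stay ((T ^^ (k - j)) (stay f) s)) t y)"
  using assms(2,3)
proof (induction k arbitrary: t y)
  case 0
  have "exp (- rate y * (t + s)) = exp (- rate y * t) * exp (- rate y * s)"
    by (simp add: distrib_left flip: exp_add)
  then show ?case
    by (simp add: stay_def ennreal_mult mult_ac)
next
  case (Suc k)
  have m: "case_prod ((T ^^ i) (stay f)) \<in> borel_measurable (borel \<Otimes>\<^sub>M S)" for i
    by measurable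
  have ms: "(T ^^ i) (stay f) s \<in> borel_measurable S" for i
    using measurable_compose[OF _ m[of i], of "\<lambda>y. (s, y)" S] by simp
  have "(T ^^ Suc k) (stay f) (t + s) y
      = T (\<lambda>r. (T ^^ k) (stay f) (r + s)) t y + stay ((T ^^ Suc k) (stay f) s) t y"
    using T_shift[OF m Suc.prems \<open>0 \<le> s\<close>] by simp
  also have "T (\<lambda>r. (T ^^ k) (stay f) (r + s)) t y
      = T (\<lambda>r z. \<Sum>j\<le>k. (T ^^ j) (stay ((T ^^ (k - j)) (stay f) s)) r z) t y"
    by (rule T_cong_space) (use Suc in auto)
  also have "\<dots> = (\<Sum>j\<le>k. (T ^^ Suc j) (stay ((T ^^ (k - j)) (stay f) s)) t y)"
    using Suc.prems ms by (subst T_sum) auto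
  also have "\<dots> + stay ((T ^^ Suc k) (stay f) s) t y
      = (\<Sum>j\<le>Suc k. (T ^^ j) (stay ((T ^^ (Suc k - j)) (stay f) s)) t y)"
    unfolding sum.atMost_Suc_shift[of _ k] by (simp add: add.commute)
  finally show ?case .
qed

theorem P_semigroup:
  assumes [measurable]: "f \<in> borel_measurable S" and y: "y \<in> space S" and "0 \<le> t" "0 \<le> s"
  shows "P (t + s) f y = P t (P s f) y"
proof -
  have m: "case_prod ((T ^^ i) (stay f)) \<in> borel_measurable (borel \<Otimes>\<^sub>M S)" for i
    by measurable
  have ms: "(T ^^ i) (stay f) s \<in> borel_measurable S" for i
    using measurable_compose[OF _ m[of i], of "\<lambda>y. (s, y)" S] by simp
  have "P (t + s) f y = (\<Sum>k. \<Sum>j\<le>k. (T ^^ j) (stay ((T ^^ (k - j)) (stay f) s)) t y)"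
    using assms by (simp add: P_def T_pow_shift)
  also have "\<dots> = (\<Sum>j. \<Sum>i. (T ^^ j) (stay ((T ^^ i) (stay f) s)) t y)"
    by (rule suminf_ennreal_convolution)
  also have "\<dots> = (\<Sum>i. P t ((T ^^ i) (stay f) s) y)"
    unfolding P_def nn_integral_count_space_nat[symmetric]
    by (rule pair_sigma_finite.Fubini'[OF pair_sigma_finite.intro[OF sigma_finite_measure_count_space sigma_finite_measure_count_space]])
      (auto intro!: measurable_pair_measure_countable1)
  also have "\<dots> = P t (P s f) y"
  proof -
    have "P s f = (\<lambda>z. \<Sum>i. (T ^^ i) (stay f) s z)" by (intro ext) (simp add: P_def)
    then show ?thesis using P_suminf[of "\<lambda>i. (T ^^ i) (stay f) s", OF ms y, where t=t] by simp
  qed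
  finally show ?thesis .
qed

text \<open>The coefficient n - i counts the particles behind gap \<open>i\<close>, so this is the
  sum of the distances of the particles to the leader. A follower lowers it by exactly the length of
  its jump, and only the leader raises it.\<close>

definition weight :: "(nat \<Rightarrow> real) \<Rightarrow> real" where
  "weight y = (\<Sum>i\<in>{1..n-1}. real (n - i) * y i)"

lemma measurable_weight [measurable]: "weight \<in> borel_measurable S"
  unfolding weight_def by measurable

lemma weight_nonneg: "y \<in> G \<Longrightarrow> 0 \<le> weight y"
  unfolding weight_def by (auto intro!: sum_nonneg mult_nonneg_nonneg simp: gap_space_nonneg)

lemma weight_hop:
  assumes "i \<in> {1..n-1}"
  shows "weight (hop i u y) = weight y - y i * u"
proof -
  have "real (n - i) - (if i = n - 1 then 0 else real (n - Suc i)) = 1"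
    using assms n2 by (auto simp: of_nat_diff)
  then show ?thesis
    unfolding weight_def by (subst sum_hop[OF assms]) (simp add: One_nat_def)
qed

lemma weight_lead: "weight (lead z y) = weight y + real (n - 1) * z"
  unfolding weight_def by (rule sum_lead)

lemma coord_le_weight:
  assumes "y \<in> G" "i \<in> {1..n-1}"
  shows "y i \<le> weight y"
proof -
  have "1 * y i \<le> real (n - i) * y i"
    using assms gap_space_nonneg[OF assms] by (intro mult_right_mono) auto
  also have "\<dots> \<le> weight y"
    unfolding weight_def
    by (rule member_le_sum) (use assms in \<open>auto intro!: mult_nonneg_nonneg simp: gap_space_nonneg\<close>)
  finally show ?thesis by simp
qed

lemma rate_le_weight:
  assumes "y \<in> G"
  shows "rate y \<le> 1 + weight y"
proof -
  have "1 * y i \<le> real (n - i) * y i" if "i \<in> {1..n-1}" for i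
    using that gap_space_nonneg[OF assms that] by (intro mult_right_mono) auto
  then show ?thesis unfolding total_rate_def weight_def by (auto intro!: sum_mono)
qed

text \<open>By the mean 1/2 of the uniform law, hops lower \<open>weight\<close> at the mean rate of
  half the sum of the squared gaps. Cauchy-Schwarz compares this with the square of
  \<open>weight\<close>, and this is the resulting constant.\<close>

definition \<epsilon> :: real where
  "\<epsilon> = 1 / (2 * (\<Sum>i\<in>{1..n-1}. (real (n - i))\<^sup>2))"

lemma eps_pos: "0 < \<epsilon>"
proof -
  have "0 < (\<Sum>i\<in>{1..n-1}. (real (n - i))\<^sup>2)"
    using n2 by (intro sum_pos) auto
  then show ?thesis by (simp add: \<epsilon>_def)
qed

lemma weight_squared_le: "\<epsilon> * (weight y)\<^sup>2 \<le> (\<Sum>i\<in>{1..n-1}. y i * y i) / 2"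
proof -
  let ?c = "\<Sum>i\<in>{1..n-1}. (real (n - i))\<^sup>2"
  have c: "0 < ?c" using n2 by (intro sum_pos) auto
  have "(weight y)\<^sup>2 \<le> ?c * (\<Sum>i\<in>{1..n-1}. (y i)\<^sup>2)"
    unfolding weight_def by (rule Cauchy_Schwarz_ineq_sum)
  then show ?thesis using c by (simp add: \<epsilon>_def divide_simps power2_eq_square mult_ac)
qed

text \<open>The first term is the flow of v' = - \<epsilon> v^2 started at \<open>weight y\<close>.
  The second is the mean input of the leader, whose jump \<open>z\<close> adds
  \<open>real (n - 1) * z\<close> to \<open>weight\<close>.\<close>

definition barrier :: "real \<Rightarrow> (nat \<Rightarrow> real) \<Rightarrow> real" where
  "barrier t y = weight y / (1 + \<epsilon> * t * weight y) + real (n - 1) * t"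

text \<open>Tangent bound for the concave map v \<mapsto> v / (1 + a v). It makes the effect of a
  hop affine in its size, as \<open>jump_op_affine_bound\<close> requires; the counterpart for
  increases serves the leader.\<close>

lemma concave_ratio_decrease:
  fixes a v x :: real
  assumes "0 \<le> a" "0 \<le> x" "x \<le> v"
  shows "(v - x) / (1 + a * (v - x)) \<le> v / (1 + a * v) - x / (1 + a * v)\<^sup>2"
proof -
  let ?p = "1 + a * (v - x)" and ?q = "1 + a * v"
  have p: "1 \<le> ?p" "?p \<le> ?q" using assms by (auto intro: mult_left_mono)
  then have pq: "0 < ?p" "0 < ?q" by linarith+
  have "x / ?q\<^sup>2 \<le> x / (?p * ?q)"
    unfolding power2_eq_square
    by (intro divide_left_mono mult_right_mono mult_pos_pos) (use p pq assms in linarith)+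
  also have "\<dots> = v / ?q - (v - x) / ?p"
  proof -
    have "?p \<noteq> 0" "?q \<noteq> 0" using p by linarith+
    then show ?thesis by (simp add: diff_frac_eq) (simp add: algebra_simps)
  qed
  finally show ?thesis by simp
qed

lemma concave_ratio_increase:
  fixes a v x :: real
  assumes "0 \<le> a" "0 \<le> x" "0 \<le> v"
  shows "(v + x) / (1 + a * (v + x)) \<le> v / (1 + a * v) + x / (1 + a * v)\<^sup>2"
proof -
  let ?p = "1 + a * (v + x)" and ?q = "1 + a * v"
  have p: "1 \<le> ?q" "?q \<le> ?p" using assms by (auto intro: mult_left_mono)
  then have pq: "0 < ?p" "0 < ?q" by linarith+
  have "(v + x) / ?p - v / ?q = x / (?p * ?q)"
  proof -
    have "?p \<noteq> 0" "?q \<noteq> 0" using p by linarith+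
    then show ?thesis by (simp add: diff_frac_eq) (simp add: algebra_simps)
  qed
  also have "\<dots> \<le> x / ?q\<^sup>2"
    unfolding power2_eq_square
    by (intro divide_left_mono mult_right_mono mult_pos_pos) (use p pq assms in linarith)+
  finally show ?thesis by simp
qed

text \<open>The slope of the concave ratio at \<open>weight y\<close> is
  \<open>1 / (?q r)\<^sup>2\<close>. The same factor multiplies the quadratic loss in the time
  derivative of the flow, so Cauchy-Schwarz is all that remains to be used.\<close>

lemma barrier_supersolution:
  assumes y: "y \<in> G" and t: "0 \<le> t"
  shows "stay (\<lambda>y. ennreal (weight y)) t y + T (\<lambda>t y. ennreal (barrier t y)) t y \<le> ennreal (barrier t y)"
proof -
  let ?v = "weight y" and ?l = "rate y" and ?m = "real (n - 1)"
  let ?q = "\<lambda>r. 1 + \<epsilon> * r * ?v"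
  let ?v' = "\<lambda>r. ?m - \<epsilon> * ?v\<^sup>2 / (?q r)\<^sup>2"
  let ?\<beta> = "\<lambda>r i. y i / (?q r)\<^sup>2"
  have v0: "0 \<le> ?v" by (rule weight_nonneg[OF y])
  have q1: "1 \<le> ?q r" if "0 \<le> r" for r using that v0 eps_pos by simp
  have \<beta>: "0 \<le> ?\<beta> r i \<and> ?\<beta> r i \<le> barrier r y" if r: "0 \<le> r" and i: "i \<in> {1..n-1}" for r i
  proof -
    have "?\<beta> r i \<le> ?v / (?q r)\<^sup>2"
      by (intro divide_right_mono coord_le_weight[OF y i]) simp
    also have "\<dots> \<le> ?v / ?q r"
      using q1[OF r] v0 by (intro divide_left_mono) (auto simp: power2_eq_square)
    also have "\<dots> \<le> barrier r y" using r by (simp add: barrier_def)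
    finally show ?thesis using gap_space_nonneg[OF y i] by simp
  qed
  have b0: "0 \<le> barrier r y" if "0 \<le> r" for r
    using that v0 q1[OF that] by (simp add: barrier_def)
  have quad: "\<epsilon> * ?v\<^sup>2 / (?q r)\<^sup>2 \<le> (\<Sum>i\<in>{1..n-1}. y i * ?\<beta> r i) / 2" for r
  proof -
    have "(\<Sum>i\<in>{1..n-1}. y i * ?\<beta> r i) / 2 = (\<Sum>i\<in>{1..n-1}. y i * y i) / 2 / (?q r)\<^sup>2"
      by (simp add: sum_divide_distrib mult.commute)
    then show ?thesis
      using divide_right_mono[OF weight_squared_le[of y], of "(?q r)\<^sup>2"] by simp
  qed
  have le: "?l * barrier r y - (\<Sum>i\<in>{1..n-1}. y i * ?\<beta> r i) / 2 + ?m / (?q r)\<^sup>2 \<le> ?l * barrier r y + ?v' r"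
    if r: "0 \<le> r" for r
  proof -
    have "1\<^sup>2 \<le> (?q r)\<^sup>2" using q1[OF r] by (intro power_mono) auto
    then have "?m / (?q r)\<^sup>2 \<le> ?m / 1" by (intro divide_left_mono) auto
    then show ?thesis using quad[of r] by simp
  qed
  have "ennreal (exp (- ?l * t) * barrier 0 y) + T (\<lambda>t y. ennreal (barrier t y)) t y \<le> ennreal (barrier t y)"
  proof (rule T_duhamel[where v'="?v'"])
    fix r :: real assume r: "0 \<le> r"
    show "((\<lambda>t. barrier t y) has_real_derivative ?v' r) (at r)"
      unfolding barrier_def using q1[OF r]
      by (auto intro!: derivative_eq_intros simp: power2_eq_square)
    have "J y (\<lambda>y. ennreal (barrier r y))
      \<le> ennreal (?l * barrier r y - (\<Sum>i\<in>{1..n-1}. y i * ?\<beta> r i) / 2 + ?m / (?q r)\<^sup>2)"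
    proof (rule jump_op_affine_bound[OF y])
      fix i u assume i: "i \<in> {1..n-1}" and u: "0 \<le> (u::real)" "u \<le> 1"
      have "y i * u \<le> ?v"
        using coord_le_weight[OF y i] mult_left_le[OF u(2) gap_space_nonneg[OF y i]] by simp
      then have "(?v - y i * u) / (1 + \<epsilon> * r * (?v - y i * u)) \<le> ?v / ?q r - y i * u / (?q r)\<^sup>2"
        using gap_space_nonneg[OF y i] u r eps_pos by (intro concave_ratio_decrease) auto
      then show "ennreal (barrier r (hop i u y)) \<le> ennreal (barrier r y - ?\<beta> r i * u)"
        unfolding barrier_def weight_hop[OF i] by (intro ennreal_leI) simp
    next
      fix z :: real assume z: "0 \<le> z"
      have "(?v + ?m * z) / (1 + \<epsilon> * r * (?v + ?m * z)) \<le> ?v / ?q r + ?m * z / (?q r)\<^sup>2"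
        using z r eps_pos v0 by (intro concave_ratio_increase) auto
      then show "ennreal (barrier r (lead z y)) \<le> ennreal (barrier r y + ?m / (?q r)\<^sup>2 * z)"
        unfolding barrier_def weight_lead by (intro ennreal_leI) simp
    qed (use \<beta>[OF r] b0[OF r] in auto)
    also have "\<dots> \<le> ennreal (?l * barrier r y + ?v' r)"
      by (intro ennreal_leI le r)
    finally show "J y (\<lambda>y. ennreal (barrier r y)) \<le> ennreal (?l * barrier r y + ?v' r)" .
    \<comment> \<open>The mean loss is at most \<open>?l * barrier r y\<close>, so the bound handed
      to \<open>T_duhamel\<close> is nonnegative.\<close>
    have "(\<Sum>i\<in>{1..n-1}. y i * ?\<beta> r i) / 2 \<le> (\<Sum>i\<in>{1..n-1}. y i * barrier r y) / 2"
      using \<beta>[OF r] gap_space_nonneg[OF y] by (intro divide_right_mono sum_mono mult_left_mono) auto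
    also have "\<dots> \<le> (\<Sum>i\<in>{1..n-1}. y i * barrier r y)"
      using b0[OF r] gap_space_nonneg[OF y] sum_nonneg[of "{1..n-1}" "\<lambda>i. y i * barrier r y"] by simp
    also have "\<dots> \<le> ?l * barrier r y"
      using b0[OF r] by (simp add: total_rate_def distrib_right sum_distrib_right)
    finally show "0 \<le> ?l * barrier r y + ?v' r"
      using le[OF r] by (smt (verit) divide_nonneg_nonneg of_nat_0_le_iff zero_le_power2)
  next
    show "(\<lambda>t. barrier t y) \<in> borel_measurable borel" unfolding barrier_def by measurable
    show "?v' \<in> borel_measurable borel" by measurable
  qed (use b0 t in auto)
  then show ?thesis using v0 by (simp add: stay_def barrier_def ennreal_mult')
qed

lemma P_weight_le:
  assumes y: "y \<in> G"
  shows "P 1 (\<lambda>y. ennreal (weight y)) y \<le> ennreal (1 / \<epsilon> + real (n - 1))"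
proof -
  have "P 1 (\<lambda>y. ennreal (weight y)) y \<le> ennreal (barrier 1 y)"
    unfolding P_def
    by (rule suminf_le_const[OF summableI])
      (rule T_pow_sum_le_supersolution[where u="\<lambda>t y. ennreal (barrier t y)"],
        use y barrier_supersolution in auto)
  also have "\<dots> \<le> ennreal (1 / \<epsilon> + real (n - 1))"
  proof (rule ennreal_leI)
    have "0 < 1 + \<epsilon> * weight y" using weight_nonneg[OF y] eps_pos by (simp add: add_pos_nonneg)
    \<comment> \<open>Here the initial state disappears from the estimate.\<close>
    then have "weight y / (1 + \<epsilon> * weight y) \<le> 1 / \<epsilon>"
      using eps_pos by (simp add: divide_simps mult.commute)
    then show "barrier 1 y \<le> 1 / \<epsilon> + real (n - 1)" by (simp add: barrier_def)
  qed
  finally show ?thesis .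
qed

text \<open>Twice the mean bound of \<open>P_weight_le\<close>, so that Markov's inequality leaves
  probability 1/2.\<close>

definition core_bound :: real where
  "core_bound = 2 * (1 / \<epsilon> + real (n - 1))"

definition core :: "(nat \<Rightarrow> real) set" where
  "core = {y \<in> G. weight y \<le> core_bound}"

lemma sets_core [measurable]: "core \<in> sets S"
proof -
  have "core = G \<inter> {y \<in> space S. weight y \<le> core_bound}"
    using gap_space_sub by (auto simp: core_def)
  also have "\<dots> \<in> sets S" using gap_space_sets by measurable
  finally show ?thesis .
qed

lemma P_core:
  assumes y: "y \<in> G"
  shows "ennreal (1/2) \<le> P 1 (indicator core) y"
proof -
  let ?K = "core_bound"
  have K: "0 < ?K" using eps_pos by (simp add: core_bound_def add_pos_nonneg)
  let ?h = "\<lambda>y. ennreal (1 / ?K) * ennreal (weight y)"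
  have "1 = P 1 (\<lambda>_. 1) y" using P_one[OF y, of 1] by simp
  \<comment> \<open>Markov's inequality in additive form; the finite summand 1/2 is cancelled at the
    end.\<close>
  also have "\<dots> \<le> P 1 (\<lambda>y. indicator core y + ?h y) y"
  proof (rule P_mono[OF y])
    fix z assume z: "z \<in> G"
    show "1 \<le> indicator core z + ?h z"
    proof (cases "z \<in> core")
      case False
      then have "1 \<le> 1 / ?K * weight z" using z K by (simp add: core_def)
      then have "1 \<le> ?h z" using K weight_nonneg[OF z]
        by (metis ennreal_ge_1 ennreal_mult' le_divide_eq_1_pos less_imp_le zero_le_divide_1_iff)
      then show ?thesis by (simp add: add_increasing)
    qed simp
  qed simp
  also have "\<dots> = P 1 (indicator core) y + ennreal (1 / ?K) * P 1 (\<lambda>y. ennreal (weight y)) y"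
    using gap_space_sub[OF y] by (simp add: P_add P_cmult)
  also have "\<dots> \<le> P 1 (indicator core) y + ennreal (1 / ?K) * ennreal (?K / 2)"
    proof (intro add_left_mono mult_left_mono)
    have "?K / 2 = 1 / \<epsilon> + real (n - 1)" by (simp add: core_bound_def)
    then show "P 1 (\<lambda>y. ennreal (weight y)) y \<le> ennreal (?K / 2)"
      using P_weight_le[OF y] by (simp only:)
  qed simp
  also have "ennreal (1 / ?K) * ennreal (?K / 2) = ennreal (1/2)"
    using K by (simp flip: ennreal_mult)
  also have "1 = ennreal (1/2) + ennreal (1/2)"
    by (subst ennreal_plus[symmetric]) auto
  finally have "ennreal (1/2) = \<infinity> \<or> ennreal (1/2) \<le> P 1 (indicator core) y"
    unfolding add.commute[of "P 1 (indicator core) y"] ennreal_add_left_cancel_le .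
  then show ?thesis by (metis ennreal_neq_top infinity_ennreal_def)
qed

end

subsection \<open>Doeblin minorization\<close>

context follow_the_leader begin

text \<open>The integral of \<open>f\<close> over a cube of side \<open>\<delta>\<close> in the last
  \<open>k\<close> gaps, the other gaps being kept. It is iterated in the order in which the
  followers jump, so that each jump accounts for one integration.\<close>

fun fill :: "real \<Rightarrow> nat \<Rightarrow> ((nat \<Rightarrow> real) \<Rightarrow> ennreal) \<Rightarrow> (nat \<Rightarrow> real) \<Rightarrow> ennreal" where
  "fill \<delta> 0 f y = f y"
| "fill \<delta> (Suc k) f y = (\<integral>\<^sup>+x. indicator {0..\<delta>} x * fill \<delta> k f (y(n - Suc k := x)) \<partial>lborel)"

lemma measurable_fill:
  assumes "f \<in> borel_measurable S" "k \<le> n - 1"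
  shows "fill \<delta> k f \<in> borel_measurable S"
  using assms(2)
proof (induction k)
  case 0
  have "fill \<delta> 0 f = f" by (intro ext) simp
  then show ?case using assms(1) by simp
next
  case (Suc k)
  then have m: "fill \<delta> k f \<in> borel_measurable S" by simp
  have "(\<lambda>p. (fst p)(n - Suc k := snd p)) \<in> measurable (S \<Otimes>\<^sub>M borel) S"
    by (rule measurable_upd) (use Suc in auto)
  from measurable_compose[OF this m]
  have [measurable]: "(\<lambda>p. fill \<delta> k f ((fst p)(n - Suc k := snd p))) \<in> borel_measurable (S \<Otimes>\<^sub>M borel)"
    by simp
  show ?case unfolding fill.simps by measurable
qed

lemma measurable_fill_upd:
  assumes "f \<in> borel_measurable S" "Suc k \<le> n - 1" "y \<in> space S"
  shows "(\<lambda>x. fill \<delta> k f (y(n - Suc k := x))) \<in> borel_measurable borel"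
proof -
  have "(\<lambda>x. y(n - Suc k := x)) \<in> measurable borel S"
    by (rule measurable_upd) (use assms in auto)
  from measurable_compose[OF this measurable_fill[OF assms(1)]] assms(2) show ?thesis by simp
qed

lemma fill_add:
  assumes "f \<in> borel_measurable S" "g \<in> borel_measurable S" "k \<le> n - 1" "y \<in> space S"
  shows "fill \<delta> k (\<lambda>z. f z + g z) y = fill \<delta> k f y + fill \<delta> k g y"
  using assms(3,4)
proof (induction k arbitrary: y)
  case (Suc k)
  have "y(n - Suc k := x) \<in> space S" for x
    using Suc.prems by (auto simp: space_PiM PiE_iff extensional_def)
  then have "fill \<delta> k (\<lambda>z. f z + g z) (y(n - Suc k := x))
      = fill \<delta> k f (y(n - Suc k := x)) + fill \<delta> k g (y(n - Suc k := x))" for x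
    using Suc.prems(1) by (intro Suc.IH) (auto simp del: fun_upd_apply)
  then have "fill \<delta> (Suc k) (\<lambda>z. f z + g z) y = (\<integral>\<^sup>+x. indicator {0..\<delta>} x * fill \<delta> k f (y(n - Suc k := x))
      + indicator {0..\<delta>} x * fill \<delta> k g (y(n - Suc k := x)) \<partial>lborel)"
    by (simp add: distrib_left)
  also have "\<dots> = fill \<delta> (Suc k) f y + fill \<delta> (Suc k) g y"
    using measurable_fill_upd[OF assms(1) Suc.prems] measurable_fill_upd[OF assms(2) Suc.prems]
    by (simp add: nn_integral_add)
  finally show ?case .
qed simp

lemma fill_const: "0 \<le> \<delta> \<Longrightarrow> fill \<delta> k (\<lambda>_. c) y = ennreal (\<delta> ^ k) * c"
proof (induction k arbitrary: y)
  case (Suc k)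
  have "fill \<delta> (Suc k) (\<lambda>_. c) y = (\<integral>\<^sup>+x. indicator {0..\<delta>} x * (ennreal (\<delta> ^ k) * c) \<partial>lborel)"
    using Suc by simp
  also have "\<dots> = (\<integral>\<^sup>+x. indicator {0..\<delta>::real} x \<partial>lborel) * (ennreal (\<delta> ^ k) * c)"
    by (rule nn_integral_multc) simp
  also have "\<dots> = ennreal (\<delta> ^ Suc k) * c"
    using Suc.prems by (simp add: ennreal_mult mult.assoc)
  finally show ?case .
qed simp

text \<open>The last \<open>k\<close> gaps are overwritten. So the length that a hop pushes into the
  next gap is forgotten, and for k = n - 1 the base point may be replaced by
  \<open>origin\<close>.\<close>

lemma fill_indep:
  assumes "k \<le> n - 1" "\<And>i. i \<notin> {n-k..n-1} \<Longrightarrow> y i = z i"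
  shows "fill \<delta> k f y = fill \<delta> k f z"
  using assms
proof (induction k arbitrary: y z)
  case 0
  then have "y i = z i" for i using n2 by (cases "i \<in> {n-0..n-1}") auto
  then have "y = z" by auto
  then show ?case by simp
next
  case (Suc k)
  have "fill \<delta> k f (y(n - Suc k := x)) = fill \<delta> k f (z(n - Suc k := x))" for x
  proof (rule Suc.IH)
    fix i assume "i \<notin> {n-k..n-1}"
    then have "i = n - Suc k \<or> i \<notin> {n - Suc k..n-1}" using Suc.prems by auto
    then show "(y(n - Suc k := x)) i = (z(n - Suc k := x)) i" using Suc.prems(2) by auto
  qed (use Suc.prems in simp)
  then show ?case by simp
qed

text \<open>Substitute for \<open>u\<close> the length x = y i (1 - u) that remains: the rate
  \<open>y i\<close> cancels the Jacobian and leaves Lebesgue measure with density 1.\<close>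

lemma jump_op_ge_hop:
  assumes [measurable]: "f \<in> borel_measurable S" "y \<in> space S" "i \<in> {1..n-1}"
    and "\<delta> \<le> y i" "0 < y i"
  shows "(\<integral>\<^sup>+x. indicator {0..\<delta>} x * f (hop i (1 - x / y i) y) \<partial>lborel) \<le> J y f"
proof -
  have "(\<integral>\<^sup>+x. indicator {0..\<delta>} x * f (hop i (1 - x / y i) y) \<partial>lborel)
      \<le> (\<integral>\<^sup>+x. indicator {0..1} (1 + (- 1 / y i) * x) * f (hop i (1 + (- 1 / y i) * x) y) \<partial>lborel)"
    using assms by (intro nn_integral_mono) (auto simp: indicator_def divide_simps)
  also have "\<dots> = ennreal (y i) * (ennreal \<bar>- 1 / y i\<bar> *
      (\<integral>\<^sup>+x. indicator {0..1} (1 + (- 1 / y i) * x) * f (hop i (1 + (- 1 / y i) * x) y) \<partial>lborel))"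
    using assms(5) by (simp add: mult.assoc[symmetric] flip: ennreal_mult)
  also have "\<dots> = ennreal (y i) * (\<integral>\<^sup>+u. indicator {0..1} u * f (hop i u y) \<partial>lborel)"
    using assms(5) by (subst nn_integral_real_affine[where c="- 1 / y i" and t=1]) auto
  also have "\<dots> \<le> (\<Sum>i\<in>{1..n-1}. ennreal (y i) * (\<integral>\<^sup>+u. indicator {0..1} u * f (hop i u y) \<partial>lborel))"
    by (rule member_le_sum) (use assms in auto)
  also have "\<dots> \<le> J y f" unfolding jump_op_hop by simp
  finally show ?thesis .
qed

text \<open>The factor t^k / k! is the volume of the ordered jump times. If all rates on the way are
  at most \<open>C\<close>, the survival factors multiply to at least \<open>exp (- C * t)\<close>
  for any such times.\<close>

lemma T_lower:
  assumes y: "y \<in> G" and C: "rate y \<le> C" and t: "0 \<le> t"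
    and J: "\<And>r. 0 \<le> r \<Longrightarrow> r \<le> t \<Longrightarrow> ennreal (exp (- C * r) * r ^ k / fact k) * a \<le> J y (\<phi> r)"
  shows "ennreal (exp (- C * t) * t ^ Suc k / fact (Suc k)) * a \<le> T \<phi> t y"
proof -
  have "(\<integral>\<^sup>+s. ennreal (exp (- C * t) * (t - s) ^ k / fact k) * indicator {0..t} s \<partial>lborel)
      = ennreal ((- exp (- C * t) * (t - t) ^ Suc k / fact (Suc k)) - (- exp (- C * t) * (t - 0) ^ Suc k / fact (Suc k)))"
  proof (rule nn_integral_FTC_Icc)
    fix s assume s: "s \<in> {0..t}"
    show "((\<lambda>s. - exp (- C * t) * (t - s) ^ Suc k / fact (Suc k)) has_real_derivative exp (- C * t) * (t - s) ^ k / fact k) (at s)"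
      by (rule derivative_eq_intros refl | simp)+
    show "0 \<le> exp (- C * t) * (t - s) ^ k / fact k" using s by simp
  qed (use t in measurable)
  then have "ennreal (exp (- C * t) * t ^ Suc k / fact (Suc k)) * a
      = (\<integral>\<^sup>+s. ennreal (exp (- C * t) * (t - s) ^ k / fact k) * indicator {0..t} s * a \<partial>lborel)"
    by (subst nn_integral_multc) auto
  also have "\<dots> \<le> T \<phi> t y"
    unfolding T_def
  proof (rule nn_integral_mono)
    fix s
    show "ennreal (exp (- C * t) * (t - s) ^ k / fact k) * indicator {0..t} s * a
        \<le> indicator {0..t} s * ennreal (exp (- rate y * s)) * J y (\<phi> (t - s))"
    proof (cases "s \<in> {0..t}")
      case True
      have eq: "exp (- C * t) * (t - s) ^ k / fact k = exp (- C * s) * (exp (- C * (t - s)) * (t - s) ^ k / fact k)"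
        by (simp add: algebra_simps flip: exp_add)
      have "ennreal (exp (- C * t) * (t - s) ^ k / fact k) * a
          = ennreal (exp (- C * s)) * (ennreal (exp (- C * (t - s)) * (t - s) ^ k / fact k) * a)"
        by (simp only: eq ennreal_mult'[OF exp_ge_zero] mult.assoc)
      also have "\<dots> \<le> ennreal (exp (- rate y * s)) * J y (\<phi> (t - s))"
        using True C by (intro mult_mono J ennreal_leI) (auto intro: mult_right_mono)
      finally show ?thesis using True by simp
    qed simp
  qed
  finally show ?thesis .
qed

text \<open>Gap n - k holds a reserve of k \<delta>; a hop that leaves at most
  \<open>\<delta>\<close> there hands at least (k - 1) \<delta> to the next gap, enough for the
  remaining hops. Hops do not raise the rate, so \<open>C\<close> survives the induction.\<close>

lemma T_pow_ge_fill:
  assumes f[measurable]: "f \<in> borel_measurable S" and \<delta>: "0 < \<delta>"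
    and "y \<in> G" "rate y \<le> C" "0 \<le> t" "k \<le> n - 1" "0 < k \<Longrightarrow> real k * \<delta> \<le> y (n - k)"
  shows "ennreal (exp (- C * t) * t ^ k / fact k) * fill \<delta> k f y \<le> (T ^^ k) (stay f) t y"
  using assms(3-)
proof (induction k arbitrary: t y)
  case 0
  then show ?case by (auto simp: stay_def intro!: mult_right_mono ennreal_leI)
next
  case (Suc k)
  let ?i = "n - Suc k"
  have i: "?i \<in> {1..n-1}" using Suc.prems n2 by auto
  have yi: "\<delta> + real k * \<delta> \<le> y ?i" using Suc.prems by (simp add: algebra_simps)
  have yi': "\<delta> \<le> y ?i" "0 < y ?i" using yi \<delta> mult_nonneg_nonneg[of "real k" \<delta>] by linarith+
  have "ennreal (exp (- C * t) * t ^ Suc k / fact (Suc k)) * fill \<delta> (Suc k) f y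
      \<le> T ((T ^^ k) (stay f)) t y"
  proof (rule T_lower[OF Suc.prems(1-3)])
    fix r assume r: "0 \<le> r" "r \<le> t"
    let ?c = "ennreal (exp (- C * r) * r ^ k / fact k)"
    have "?c * fill \<delta> (Suc k) f y = (\<integral>\<^sup>+x. ?c * (indicator {0..\<delta>} x * fill \<delta> k f (y(?i := x))) \<partial>lborel)"
      using measurable_fill_upd[OF f Suc.prems(4) gap_space_sub[OF Suc.prems(1)]]
      by (simp add: nn_integral_cmult)
    also have "\<dots> \<le> (\<integral>\<^sup>+x. indicator {0..\<delta>} x * (T ^^ k) (stay f) r (hop ?i (1 - x / y ?i) y) \<partial>lborel)"
    proof (rule nn_integral_mono)
      fix x
      show "?c * (indicator {0..\<delta>} x * fill \<delta> k f (y(?i := x)))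
          \<le> indicator {0..\<delta>} x * (T ^^ k) (stay f) r (hop ?i (1 - x / y ?i) y)"
      proof (cases "x \<in> {0..\<delta>}")
        case True
        let ?u = "1 - x / y ?i" and ?z = "hop ?i (1 - x / y ?i) y"
        have u: "0 \<le> ?u" "?u \<le> 1" using True yi' by (auto simp: divide_simps)
        have x: "y ?i - y ?i * ?u = x" using yi' by (simp add: field_simps)
        have "fill \<delta> k f (y(?i := x)) = fill \<delta> k f ?z"
        proof (rule fill_indep)
          \<comment> \<open>Besides \<open>?i\<close>, which now has length \<open>x\<close>, the
            hop alters at most gap n - k, and that one lies in the overwritten range.\<close>
          fix j assume j: "j \<notin> {n-k..n-1}"
          show "(y(?i := x)) j = ?z j"
            using j Suc.prems(4) unfolding hop_def x by auto
        qed (use Suc.prems in simp)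
        moreover have "?c * fill \<delta> k f ?z \<le> (T ^^ k) (stay f) r ?z"
        proof (rule Suc.IH)
          show "?z \<in> G" by (rule hop_gap_space[OF Suc.prems(1) i u])
          show "rate ?z \<le> C"
            using rate_hop_le[OF Suc.prems(1) i u(1)] Suc.prems(2) by simp
          assume k: "0 < k"
          then have si: "n - k = Suc ?i" "?i \<noteq> n - 1" "Suc ?i \<in> {1..n-1}" using Suc.prems(4) by auto
          have "y ?i * ?u = y ?i - x" using x by simp
          then have "?z (n - k) = y (Suc ?i) + (y ?i - x)" using si by (simp add: hop_def)
          then show "real k * \<delta> \<le> ?z (n - k)"
            using gap_space_nonneg[OF Suc.prems(1) si(3)] yi True by simp
        qed (use Suc.prems r in auto)
        ultimately show ?thesis using True by simp
      qed simp
    qed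
    also have "\<dots> \<le> J y ((T ^^ k) (stay f) r)"
    proof (rule jump_op_ge_hop)
      have "case_prod ((T ^^ k) (stay f)) \<in> borel_measurable (borel \<Otimes>\<^sub>M S)" by measurable
      from measurable_compose[OF _ this, of "\<lambda>y. (r, y)" S]
      show "(T ^^ k) (stay f) r \<in> borel_measurable S" by simp
    qed (use i yi' gap_space_sub[OF Suc.prems(1)] in auto)
    finally show "?c * fill \<delta> (Suc k) f y \<le> J y ((T ^^ k) (stay f) r)" .
  qed
  then show ?case by simp
qed

text \<open>Both ends matter: \<open>a\<close> bounds from below the length that the leader
  supplies, \<open>b\<close> bounds from above the rate after its jump. Countably many such
  intervals exhaust the positive half-line.\<close>

lemma theta_interval: "\<exists>a b. 0 < a \<and> 0 < emeasure \<theta> {a..b}"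
proof (rule ccontr)
  assume "\<not> ?thesis"
  then have z: "emeasure \<theta> {1 / real (Suc k)..real (Suc k)} = 0" for k
    by (metis not_gr_zero of_nat_0_less_iff zero_less_Suc zero_less_divide_1_iff)
  have "{0<..} \<subseteq> (\<Union>k. {1 / real (Suc k)..real (Suc k)})"
  proof
    fix x :: real assume "x \<in> {0<..}"
    then have x: "0 < x" by simp
    obtain k :: nat where k: "max x (1 / x) < real k" using reals_Archimedean2 by blast
    then have "1 / x \<le> real (Suc k)" "x \<le> real (Suc k)" by auto
    then have "1 / real (Suc k) \<le> x" using x by (simp add: divide_simps mult.commute)
    then show "x \<in> (\<Union>k. {1 / real (Suc k)..real (Suc k)})"
      using \<open>x \<le> real (Suc k)\<close> by auto
  qed
  then have "emeasure \<theta> {0<..} \<le> emeasure \<theta> (\<Union>k. {1 / real (Suc k)..real (Suc k)})"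
    by (intro emeasure_mono) (auto simp: theta_sets)
  also have "\<dots> = 0"
    by (rule emeasure_UN_eq_0) (use z in \<open>auto simp: theta_sets\<close>)
  finally show False using theta_pos by simp
qed

definition origin :: "nat \<Rightarrow> real" where
  "origin = (\<lambda>i\<in>{1..n-1}. 0)"

lemma origin_G: "origin \<in> G"
  by (simp add: gap_space_def origin_def)

lemma minorization_core:
  "\<exists>q \<delta>. 0 < q \<and> 0 < \<delta> \<and>
     (\<forall>f\<in>borel_measurable S. \<forall>y\<in>core. ennreal q * fill \<delta> (n - 1) f origin \<le> P 1 f y)"
proof -
  obtain a b where a: "0 < a" and ab: "0 < emeasure \<theta> {a..b}" using theta_interval by blast
  interpret prob_space \<theta> by (rule theta_prob)
  define p where "p = measure \<theta> {a..b}"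
  have p: "0 < p" using ab by (simp add: p_def emeasure_eq_measure)
  \<comment> \<open>A single leader jump of size at least \<open>a\<close> has to provide
    \<open>\<delta>\<close> for each of the n - 1 gaps.\<close>
  define \<delta> where "\<delta> = a / real (n - 1)"
  have \<delta>: "0 < \<delta>" "real (n - 1) * \<delta> = a" using a n2 by (auto simp: \<delta>_def)
  \<comment> \<open>Bounds the rate on \<open>core\<close>, including its growth by a leader jump of
    size at most \<open>b\<close>.\<close>
  define C where "C = 1 + core_bound + \<bar>b\<bar>"
  \<comment> \<open>One jump of the leader, with probability weight \<open>p\<close>, and n - 1 of
    the followers within unit time: \<open>n\<close> ordered jump times, hence the
    factorial.\<close>
  define q where "q = exp (- C) / fact n * p"
  have q: "0 < q" using p by (simp add: q_def)
  have "ennreal q * fill \<delta> (n - 1) f origin \<le> P 1 f y"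
    if f[measurable]: "f \<in> borel_measurable S" and "y \<in> core" for f y
  proof -
    have y: "y \<in> G" and w: "weight y \<le> core_bound" using that by (auto simp: core_def)
    have nk: "n = Suc (n - 1)" using n2 by simp
    let ?b = "ennreal p * fill \<delta> (n - 1) f origin"
    have "ennreal (exp (- C * 1) * 1 ^ Suc (n - 1) / fact (Suc (n - 1))) * ?b \<le> T ((T ^^ (n - 1)) (stay f)) 1 y"
    proof (rule T_lower[OF y])
      show "rate y \<le> C" using rate_le_weight[OF y] w by (simp add: C_def)
      fix r :: real assume r: "0 \<le> r"
      let ?c = "ennreal (exp (- C * r) * r ^ (n - 1) / fact (n - 1))"
      have "?c * ?b = (\<integral>\<^sup>+z. ?c * fill \<delta> (n - 1) f origin * indicator {a..b} z \<partial>\<theta>)"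
        by (subst nn_integral_cmult) (auto simp: p_def emeasure_eq_measure mult_ac)
      also have "\<dots> \<le> (\<integral>\<^sup>+z. (T ^^ (n - 1)) (stay f) r (lead z y) \<partial>\<theta>)"
      proof (rule nn_integral_mono)
        fix z
        show "?c * fill \<delta> (n - 1) f origin * indicator {a..b} z \<le> (T ^^ (n - 1)) (stay f) r (lead z y)"
        proof (cases "z \<in> {a..b}")
          case True
          have "fill \<delta> (n - 1) f origin = fill \<delta> (n - 1) f (lead z y)"
          proof (rule fill_indep)
            fix i assume "i \<notin> {n - (n - 1)..n - 1}"
            then have "i \<notin> {1..n-1}" using n2 by auto
            then show "origin i = lead z y i"
              using y n2 by (auto simp: origin_def lead_def gap_space_def extensional_def)
          qed simp
          moreover have "?c * fill \<delta> (n - 1) f (lead z y) \<le> (T ^^ (n - 1)) (stay f) r (lead z y)"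
          proof (rule T_pow_ge_fill[OF f \<delta>(1)])
            show "lead z y \<in> G" using True a by (intro lead_gap_space[OF y]) simp
            show "rate (lead z y) \<le> C"
              using True rate_le_weight[OF y] w abs_ge_self[of b] unfolding rate_lead C_def
              by simp
            have "n - (n - 1) = 1" "1 \<in> {1..n-1}" using n2 by auto
            then show "real (n - 1) * \<delta> \<le> lead z y (n - (n - 1))"
              using True gap_space_nonneg[OF y, of 1] unfolding \<delta>(2) by (simp add: lead_def)
          qed (use r in auto)
          ultimately show ?thesis using True by simp
        qed simp
      qed
      also have "\<dots> \<le> J y ((T ^^ (n - 1)) (stay f) r)" unfolding jump_op_hop by simp
      finally show "?c * ?b \<le> J y ((T ^^ (n - 1)) (stay f) r)" .
    qed simp
    also have "\<dots> = (T ^^ n) (stay f) 1 y" by (subst (2) nk) simp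
    also have "\<dots> \<le> P 1 f y"
      unfolding P_def using sum_le_suminf[OF summableI, of "{n}" "\<lambda>k. (T ^^ k) (stay f) 1 y"] by simp
    finally have "ennreal (exp (- C) / fact n) * ?b \<le> P 1 f y"
      unfolding nk[symmetric] by simp
    moreover have "ennreal q = ennreal (exp (- C) / fact n) * ennreal p"
      unfolding q_def using p by (intro ennreal_mult) auto
    ultimately show ?thesis by (simp add: mult.assoc)
  qed
  then show ?thesis using q \<delta> by blast
qed

text \<open>Of the minorizing measure only additivity and the values at constants are needed, so it
  appears as a functional \<open>N\<close>. Reaching \<open>core\<close> costs a factor 1/2; the
  other 1/2 in \<open>q / 4\<close> gives \<open>2 * N f \<le> P 2 f y\<close>, and f = 1 then
  forces its mass below 1.\<close>

lemma doeblin: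
  "\<exists>N \<epsilon>. 0 < \<epsilon> \<and> \<epsilon> < 1 \<and>
     (\<forall>f\<in>borel_measurable S. \<forall>g\<in>borel_measurable S. N (\<lambda>z. f z + g z) = N f + N g) \<and>
     (\<forall>c. N (\<lambda>_. c) = ennreal \<epsilon> * c) \<and>
     (\<forall>f\<in>borel_measurable S. \<forall>y\<in>G. N f \<le> P 2 f y)"
proof -
  obtain q \<delta> where q: "0 < q" and \<delta>: "0 < \<delta>"
    and minor: "\<And>f y. f \<in> borel_measurable S \<Longrightarrow> y \<in> core \<Longrightarrow> ennreal q * fill \<delta> (n - 1) f origin \<le> P 1 f y"
    using minorization_core by blast
  define N where "N f = ennreal (q / 4) * fill \<delta> (n - 1) f origin" for f
  define e where "e = q / 4 * \<delta> ^ (n - 1)"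
  have e: "0 < e" using q \<delta> by (simp add: e_def)
  have o: "origin \<in> space S" by (rule gap_space_sub[OF origin_G])
  have const: "N (\<lambda>_. c) = ennreal e * c" for c
    using q \<delta> unfolding N_def e_def by (subst ennreal_mult) (auto simp: fill_const mult.assoc)
  have lower: "2 * N f \<le> P 2 f y" if [measurable]: "f \<in> borel_measurable S" and y: "y \<in> G" for f y
  proof -
    let ?a = "ennreal q * fill \<delta> (n - 1) f origin"
    have "2 * N f = ?a * ennreal (1/2)"
    proof -
      have "2 * ennreal (q / 4) = ennreal q * ennreal (1/2)"
      proof -
        have "2 * ennreal (q / 4) = ennreal (2 * (q / 4))" using q by (subst ennreal_mult) auto
        also have "2 * (q / 4) = q * (1/2)" by simp
        also have "ennreal (q * (1/2)) = ennreal q * ennreal (1/2)" using q by (intro ennreal_mult) auto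
        finally show ?thesis .
      qed
      then show ?thesis by (simp add: N_def mult_ac flip: mult.assoc)
    qed
    also have "\<dots> \<le> ?a * P 1 (indicator core) y"
      by (intro mult_left_mono P_core[OF y]) simp
    also have "\<dots> = P 1 (\<lambda>z. ?a * indicator core z) y"
      using gap_space_sub[OF y] by (simp add: P_cmult)
    also have "\<dots> \<le> P 1 (P 1 f) y"
      using y by (intro P_mono) (auto simp: indicator_def intro!: minor)
    also have "\<dots> = P 2 f y"
      using P_semigroup[of f y 1 1] gap_space_sub[OF y] by simp
    finally show ?thesis .
  qed
  have "2 * ennreal e \<le> 1"
    using lower[of "\<lambda>_. 1" origin] const[of 1] P_one[OF origin_G, of 2] origin_G by simp
  then have "e < 1"
    using e by (simp flip: ennreal_numeral ennreal_mult ennreal_1)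
  moreover have "N f \<le> P 2 f y" if "f \<in> borel_measurable S" "y \<in> G" for f y
    using lower[OF that] by (rule order_trans[rotated]) (simp add: mult_2)
  moreover have "N (\<lambda>z. f z + g z) = N f + N g" if "f \<in> borel_measurable S" "g \<in> borel_measurable S" for f g
    using fill_add[OF that order_refl o] by (simp add: N_def distrib_left)
  ultimately show ?thesis
    using e const by (intro exI[of _ N] exI[of _ e]) auto
qed

end

subsection \<open>Contraction and the invariant law\<close>

lemma abs_enn2real_diff_le:
  assumes "0 \<le> a" "0 \<le> d" "ennreal a \<le> x" "x \<le> ennreal (a + d)" "ennreal a \<le> y" "y \<le> ennreal (a + d)"
  shows "\<bar>enn2real x - enn2real y\<bar> \<le> d"
proof -
  have "a \<le> enn2real z \<and> enn2real z \<le> a + d" if "ennreal a \<le> z" "z \<le> ennreal (a + d)" for z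
  proof -
    from that obtain r where "0 \<le> r" "z = ennreal r" by (cases z) (auto simp: top_unique)
    then show ?thesis using that assms(1,2) by (simp del: ennreal_plus)
  qed
  from this[of x] this[of y] assms show ?thesis by auto
qed

context follow_the_leader begin

text \<open>Put g = f - a and h = b - f. The numbers N g and N h do not depend on the point and add
  up to e (b - a); one raises the lower bound of \<open>P 2 f\<close>, the other lowers the upper
  bound.\<close>

lemma oscillation_step:
  "\<exists>e. 0 < e \<and> e < 1 \<and> (\<forall>f\<in>borel_measurable S. \<forall>a b. 0 \<le> a \<longrightarrow> a \<le> b \<longrightarrow>
     (\<forall>z\<in>G. ennreal a \<le> f z \<and> f z \<le> ennreal b) \<longrightarrow>
     (\<exists>a'\<ge>a. \<forall>z\<in>G. ennreal a' \<le> P 2 f z \<and> P 2 f z \<le> ennreal (a' + (1 - e) * (b - a))))"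
proof -
  obtain N e where e: "0 < e" "e < 1"
    and add: "\<And>f g. f \<in> borel_measurable S \<Longrightarrow> g \<in> borel_measurable S \<Longrightarrow> N (\<lambda>z. f z + g z) = N f + N g"
    and const: "\<And>c. N (\<lambda>_. c) = ennreal e * c"
    and minor: "\<And>f y. f \<in> borel_measurable S \<Longrightarrow> y \<in> G \<Longrightarrow> N f \<le> P 2 f y"
    using doeblin by blast
  have "\<exists>a'\<ge>a. \<forall>z\<in>G. ennreal a' \<le> P 2 f z \<and> P 2 f z \<le> ennreal (a' + (1 - e) * (b - a))"
    if [measurable]: "f \<in> borel_measurable S" and ab: "0 \<le> a" "a \<le> b"
      and f: "\<And>z. z \<in> G \<Longrightarrow> ennreal a \<le> f z \<and> f z \<le> ennreal b" for f a b
  proof -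
    \<comment> \<open>Clamping extends the bounds beyond \<open>G\<close>: the sum g + h must be
      constant everywhere for its value under \<open>N\<close> to be known.\<close>
    define f' where "f' z = max (ennreal a) (min (ennreal b) (f z))" for z
    define g where "g z = f' z - ennreal a" for z
    define h where "h z = ennreal b - f' z" for z
    have f': "ennreal a \<le> f' z" "f' z \<le> ennreal b" for z
      using ab by (auto simp: f'_def)
    have ff': "f z = f' z" if "z \<in> G" for z using f[OF that] by (simp add: f'_def min_absorb2 max_absorb2)
    have [measurable]: "f' \<in> borel_measurable S" unfolding f'_def by measurable
    have [measurable]: "g \<in> borel_measurable S" unfolding g_def by measurable
    have [measurable]: "h \<in> borel_measurable S" unfolding h_def by measurable
    have ag: "f' z = ennreal a + g z" for z
      using f'(1)[of z] unfolding g_def by (simp add: add_diff_inverse_ennreal)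
    have gh: "g z + h z = ennreal (b - a)" for z
    proof -
      from f'[of z] obtain r where r: "0 \<le> r" "f' z = ennreal r" by (cases "f' z") (auto simp: top_unique)
      then have "a \<le> r" "r \<le> b" using f'[of z] ab by auto
      then show ?thesis using r ab by (simp add: g_def h_def ennreal_minus flip: ennreal_plus)
    qed
    have Ngh: "N g + N h = ennreal (e * (b - a))"
      using add[of g h] const[of "ennreal (b - a)"] e ab by (simp add: gh ennreal_mult)
    then have "N g \<le> ennreal (e * (b - a))" by (metis le_iff_add)
    then obtain \<gamma> where \<gamma>: "0 \<le> \<gamma>" "N g = ennreal \<gamma>" by (cases "N g") (auto simp: top_unique)
    from Ngh have "N h \<le> ennreal (e * (b - a))" by (metis le_iff_add add.commute)
    then obtain \<eta> where \<eta>: "0 \<le> \<eta>" "N h = ennreal \<eta>" by (cases "N h") (auto simp: top_unique)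
    have sum: "\<gamma> + \<eta> = e * (b - a)"
      using Ngh \<gamma> \<eta> e ab by (simp flip: ennreal_plus)
    have "ennreal (a + \<gamma>) \<le> P 2 f z \<and> P 2 f z \<le> ennreal (a + \<gamma> + (1 - e) * (b - a))" if z: "z \<in> G" for z
    proof -
      have zS: "z \<in> space S" by (rule gap_space_sub[OF z])
      have "P 2 f z = P 2 (\<lambda>z. ennreal a + g z) z"
        using z by (intro P_cong) (simp_all add: ff' ag)
      also have "\<dots> = ennreal a + P 2 g z"
        using zS P_const[OF z] by (simp add: P_add)
      finally have Pf: "P 2 f z = ennreal a + P 2 g z" .
      have "P 2 g z + P 2 h z = P 2 (\<lambda>z. g z + h z) z"
        using zS by (simp add: P_add)
      then have Pgh: "P 2 g z + P 2 h z = ennreal (b - a)"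
        using P_const[OF z] by (simp add: gh)
      then have "P 2 g z \<le> ennreal (b - a)" by (metis le_iff_add)
      then obtain p where p: "0 \<le> p" "P 2 g z = ennreal p" by (cases "P 2 g z") (auto simp: top_unique)
      have "ennreal p + ennreal \<eta> \<le> ennreal (b - a)"
        using minor[of h z] z Pgh p \<eta> by (metis \<open>h \<in> borel_measurable S\<close> add_left_mono)
      then have "p + \<eta> \<le> b - a" using p \<eta> ab by (simp flip: ennreal_plus)
      moreover have "\<gamma> \<le> p" using minor[of g z] z p \<gamma> by simp
      moreover have "ennreal a + ennreal p = ennreal (a + p)" using ab p by simp
      ultimately show ?thesis unfolding Pf p using sum
        by (auto intro!: ennreal_leI simp: algebra_simps)
    qed
    then show ?thesis using \<gamma>(1) by (intro exI[of _ "a + \<gamma>"]) auto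
  qed
  then show ?thesis using e by (intro exI[of _ e]) blast
qed

text \<open>One interval serves all later times, because \<open>P s\<close> is an average and
  preserves bounds. This permits comparing different times as well as different points.\<close>

lemma oscillation:
  "\<exists>e. 0 < e \<and> e < 1 \<and> (\<forall>f\<in>borel_measurable S. (\<forall>z\<in>G. f z \<le> 1) \<longrightarrow>
     (\<forall>k. \<exists>a\<ge>0. \<forall>t\<ge>2 * real k. \<forall>z\<in>G. ennreal a \<le> P t f z \<and> P t f z \<le> ennreal (a + (1 - e) ^ k)))"
proof -
  obtain e where e: "0 < e" "e < 1"
    and step: "\<And>f a b. f \<in> borel_measurable S \<Longrightarrow> 0 \<le> a \<Longrightarrow> a \<le> b \<Longrightarrow> (\<forall>z\<in>G. ennreal a \<le> f z \<and> f z \<le> ennreal b) \<Longrightarrow>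
      \<exists>a'\<ge>a. \<forall>z\<in>G. ennreal a' \<le> P 2 f z \<and> P 2 f z \<le> ennreal (a' + (1 - e) * (b - a))"
    using oscillation_step by blast
  have "\<exists>a\<ge>0. \<forall>t\<ge>2 * real k. \<forall>z\<in>G. ennreal a \<le> P t f z \<and> P t f z \<le> ennreal (a + (1 - e) ^ k)"
    if [measurable]: "f \<in> borel_measurable S" and f: "\<forall>z\<in>G. f z \<le> 1" for f k
  proof (induction k)
    case 0
    have "P t f z \<le> 1" if "0 \<le> t" "z \<in> G" for t z
      using P_mono[OF that(2,1), of f "\<lambda>_. 1"] P_one[OF that(2,1)] f by simp
    then show ?case by (intro exI[of _ 0]) auto
  next
    case (Suc k)
    then obtain a where a: "0 \<le> a" "\<forall>z\<in>G. ennreal a \<le> P (2 * real k) f z \<and> P (2 * real k) f z \<le> ennreal (a + (1 - e) ^ k)"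
      by blast
    obtain a' where a': "a \<le> a'"
      "\<forall>z\<in>G. ennreal a' \<le> P 2 (P (2 * real k) f) z \<and> P 2 (P (2 * real k) f) z \<le> ennreal (a' + (1 - e) * ((a + (1 - e) ^ k) - a))"
      using step[OF _ a(1) _ a(2)] e by auto
    have bnd: "ennreal a' \<le> P (2 * real (Suc k)) f z \<and> P (2 * real (Suc k)) f z \<le> ennreal (a' + (1 - e) ^ Suc k)"
      if "z \<in> G" for z
      using a'(2) that P_semigroup[of f z 2 "2 * real k"] gap_space_sub[OF that] by (simp add: algebra_simps)
    have "ennreal a' \<le> P t f z \<and> P t f z \<le> ennreal (a' + (1 - e) ^ Suc k)"
      if t: "2 * real (Suc k) \<le> t" and z: "z \<in> G" for t z
    proof -
      define s where "s = t - 2 * real (Suc k)"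
      have s: "0 \<le> s" "t = s + 2 * real (Suc k)" using t by (auto simp: s_def)
      have "P t f z = P s (P (2 * real (Suc k)) f) z"
        unfolding s(2) using s(1) gap_space_sub[OF z] by (intro P_semigroup) auto
      moreover have "P s (\<lambda>_. ennreal a') z \<le> P s (P (2 * real (Suc k)) f) z"
        using bnd z s by (intro P_mono) auto
      moreover have "P s (P (2 * real (Suc k)) f) z \<le> P s (\<lambda>_. ennreal (a' + (1 - e) ^ Suc k)) z"
        using bnd z s by (intro P_mono) auto
      ultimately show ?thesis using P_const[OF z s(1)] by simp
    qed
    then show ?case using a(1) a'(1) by (intro exI[of _ a']) auto
  qed
  then show ?thesis using e by (intro exI[of _ e]) blast
qed

text \<open>Sampled at multiples of the Doeblin time 2; by \<open>contraction\<close> every starting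
  point leads to the same limit.\<close>

definition prob_at :: "nat \<Rightarrow> (nat \<Rightarrow> real) set \<Rightarrow> real" where
  "prob_at k A = enn2real (P (2 * real k) (indicator A) origin)"

definition limit_prob :: "(nat \<Rightarrow> real) set \<Rightarrow> real" where
  "limit_prob A = lim (\<lambda>k. prob_at k A)"

definition invariant_law :: "(nat \<Rightarrow> real) measure" where
  "invariant_law = measure_of G (sets (gap_measure n)) (\<lambda>A. ennreal (limit_prob A))"

lemma P_indicator_le_1: "y \<in> G \<Longrightarrow> 0 \<le> t \<Longrightarrow> P t (indicator A) y \<le> 1"
  using P_mono[of y t "indicator A" "\<lambda>_. 1"] P_one[of y t] by (simp add: indicator_def)

lemma ennreal_prob_at: "ennreal (prob_at k A) = P (2 * real k) (indicator A) origin"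
proof -
  have "P (2 * real k) (indicator A) origin \<le> 1"
    by (rule P_indicator_le_1[OF origin_G]) simp
  then have "P (2 * real k) (indicator A) origin < \<top>"
    by (rule order.strict_trans1) simp
  then show ?thesis unfolding prob_at_def by simp
qed

lemma contraction:
  "\<exists>e. 0 < e \<and> e < 1 \<and> (\<forall>f\<in>borel_measurable S. (\<forall>z\<in>G. f z \<le> 1) \<longrightarrow>
     (\<forall>k t s. \<forall>y\<in>G. \<forall>z\<in>G. 2 * real k \<le> t \<longrightarrow> 2 * real k \<le> s \<longrightarrow>
        \<bar>enn2real (P t f y) - enn2real (P s f z)\<bar> \<le> (1 - e) ^ k))"
proof -
  obtain e where e: "0 < e" "e < 1" and osc: "\<And>f k. f \<in> borel_measurable S \<Longrightarrow> (\<forall>z\<in>G. f z \<le> 1) \<Longrightarrow>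
     \<exists>a\<ge>0. \<forall>t\<ge>2 * real k. \<forall>z\<in>G. ennreal a \<le> P t f z \<and> P t f z \<le> ennreal (a + (1 - e) ^ k)"
    using oscillation by blast
  have "\<bar>enn2real (P t f y) - enn2real (P s f z)\<bar> \<le> (1 - e) ^ k"
    if f: "f \<in> borel_measurable S" "\<forall>z\<in>G. f z \<le> 1"
      and *: "2 * real k \<le> t" "2 * real k \<le> s" "y \<in> G" "z \<in> G" for f k t s y z
  proof -
    obtain a where a: "0 \<le> a" "\<forall>t\<ge>2 * real k. \<forall>z\<in>G. ennreal a \<le> P t f z \<and> P t f z \<le> ennreal (a + (1 - e) ^ k)"
      using osc[OF f] by blast
    show ?thesis
      by (rule abs_enn2real_diff_le[OF a(1)]) (use a(2) * e in auto)
  qed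
  then show ?thesis using e by (intro exI[of _ e]) blast
qed

section \<open>Setwise limits of the transition probabilities\<close>

lemma gap_measure_sets_S: "A \<in> sets (gap_measure n) \<Longrightarrow> A \<in> sets S"
  by (simp add: sets_gap_measure)

lemma space_gap_measure: "space (gap_measure n) = G"
  using gap_space_sub by (auto simp: gap_measure_def space_restrict_space)

lemma prob_at_LIMSEQ:
  assumes "A \<in> sets S"
  shows "(\<lambda>k. prob_at k A) \<longlonglongrightarrow> limit_prob A"
proof -
  obtain e where e: "0 < e" "e < 1" and
    c: "\<forall>f\<in>borel_measurable S. (\<forall>z\<in>G. f z \<le> 1) \<longrightarrow>
     (\<forall>k t s. \<forall>y\<in>G. \<forall>z\<in>G. 2 * real k \<le> t \<longrightarrow> 2 * real k \<le> s \<longrightarrow>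
        \<bar>enn2real (P t f y) - enn2real (P s f z)\<bar> \<le> (1 - e) ^ k)"
    using contraction by (elim exE conjE)
  note c = c[rule_format]
  have "Cauchy (\<lambda>k. prob_at k A)"
  proof (rule metric_CauchyI)
    fix r :: real assume r: "0 < r"
    obtain k where k: "(1 - e) ^ k < r"
      using real_arch_pow_inv[OF r, of "1 - e"] e by auto
    have "dist (prob_at i A) (prob_at j A) < r" if "k \<le> i" "k \<le> j" for i j
    proof -
      have "\<bar>prob_at i A - prob_at j A\<bar> \<le> (1 - e) ^ k"
        unfolding prob_at_def using assms that by (intro c origin_G) (auto simp: indicator_def)
      then show ?thesis using k by (simp add: dist_real_def)
    qed
    then show "\<exists>M. \<forall>m\<ge>M. \<forall>n\<ge>M. dist (prob_at m A) (prob_at n A) < r" by blast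
  qed
  then show ?thesis
    unfolding limit_prob_def by (simp add: Cauchy_convergent convergent_LIMSEQ_iff[symmetric])
qed

lemma uniform_convergence:
  "\<exists>e. 0 < e \<and> e < 1 \<and> (\<forall>A\<in>sets S. \<forall>k t. \<forall>y\<in>G. 2 * real k \<le> t \<longrightarrow>
     \<bar>enn2real (P t (indicator A) y) - limit_prob A\<bar> \<le> (1 - e) ^ k)"
proof -
  obtain e where e: "0 < e" "e < 1" and
    c: "\<forall>f\<in>borel_measurable S. (\<forall>z\<in>G. f z \<le> 1) \<longrightarrow>
     (\<forall>k t s. \<forall>y\<in>G. \<forall>z\<in>G. 2 * real k \<le> t \<longrightarrow> 2 * real k \<le> s \<longrightarrow>
        \<bar>enn2real (P t f y) - enn2real (P s f z)\<bar> \<le> (1 - e) ^ k)"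
    using contraction by (elim exE conjE)
  note c = c[rule_format]
  have "\<bar>enn2real (P t (indicator A) y) - limit_prob A\<bar> \<le> (1 - e) ^ k"
    if A: "A \<in> sets S" and *: "2 * real k \<le> t" "y \<in> G" for A k t y
  proof -
    have "(\<lambda>j. \<bar>enn2real (P t (indicator A) y) - prob_at j A\<bar>) \<longlonglongrightarrow> \<bar>enn2real (P t (indicator A) y) - limit_prob A\<bar>"
      by (intro tendsto_intros prob_at_LIMSEQ A)
    moreover have "\<forall>j\<ge>k. \<bar>enn2real (P t (indicator A) y) - prob_at j A\<bar> \<le> (1 - e) ^ k"
      unfolding prob_at_def using A * by (auto intro!: c origin_G simp: indicator_def)
    ultimately show ?thesis
      by (rule LIMSEQ_le_const2[OF _ exI[of _ k]])
  qed
  then show ?thesis using e by (intro exI[of _ e]) blast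
qed

text \<open>At a fixed time, countable additivity of \<open>P\<close> gives a measure, which is
  continuous at the empty set. The countable additivity of the limit is deduced from this.\<close>

lemma prob_at_decseq_LIMSEQ:
  assumes A: "range A \<subseteq> sets S" "decseq A" "(\<Inter>i. A i) = {}"
  shows "(\<lambda>i. prob_at k (A i)) \<longlonglongrightarrow> 0"
proof -
  let ?\<mu> = "\<lambda>A. P (2 * real k) (indicator A) origin"
  define K where "K = measure_of (space S) (sets S) ?\<mu>"
  have o: "origin \<in> space S" by (rule gap_space_sub[OF origin_G])
  have "countably_additive (sets S) ?\<mu>"
  proof (rule countably_additiveI)
    fix B :: "nat \<Rightarrow> _" assume B: "range B \<subseteq> sets S" "disjoint_family B"
    have "(\<Sum>i. ?\<mu> (B i)) = P (2 * real k) (\<lambda>z. \<Sum>i. indicator (B i) z) origin"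
      using B o by (intro P_suminf[symmetric]) auto
    also have "(\<lambda>z. \<Sum>i. indicator (B i) z) = (indicator (\<Union>i. B i) :: _ \<Rightarrow> ennreal)"
      using B(2) by (intro ext suminf_indicator)
    finally show "(\<Sum>i. ?\<mu> (B i)) = ?\<mu> (\<Union>i. B i)" .
  qed
  moreover have "positive (sets S) ?\<mu>"
    using P_const[OF origin_G, of "2 * real k" 0] by (simp add: positive_def indicator_def[abs_def])
  ultimately have K: "emeasure K B = ?\<mu> B" if "B \<in> sets S" for B
    unfolding K_def using that by (intro emeasure_measure_of_sigma sets.sigma_algebra_axioms)
  have "(\<lambda>i. emeasure K (A i)) \<longlonglongrightarrow> emeasure K (\<Inter>i. A i)"
  proof (rule Lim_emeasure_decseq[OF _ A(2)])
    show "range A \<subseteq> sets K" using A(1) by (simp add: K_def)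
    show "emeasure K (A i) \<noteq> \<infinity>" for i
      using A(1) by (subst K) (auto simp flip: ennreal_prob_at)
  qed
  then have "(\<lambda>i. ennreal (prob_at k (A i))) \<longlonglongrightarrow> ennreal 0"
    using A by (simp add: K ennreal_prob_at range_subsetD)
  then show ?thesis
    by (subst (asm) tendsto_ennreal_iff) (auto simp: prob_at_def)
qed

lemma limit_prob_nonneg: "A \<in> sets S \<Longrightarrow> 0 \<le> limit_prob A"
  by (rule LIMSEQ_le_const[OF prob_at_LIMSEQ]) (auto simp: prob_at_def)

text \<open>Finite additivity passes to the limit. Continuity at the empty set needs convergence
  uniform over sets: one fixed time then approximates the limit along the whole decreasing
  sequence.\<close>

lemma emeasure_invariant_law:
  assumes "A \<in> sets (gap_measure n)"
  shows "emeasure invariant_law A = ennreal (limit_prob A)"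
proof -
  let ?M = "sets (gap_measure n)"
  let ?\<mu> = "\<lambda>A. ennreal (limit_prob A)"
  obtain e where e: "0 < e" "e < 1" and
    u: "\<forall>A\<in>sets S. \<forall>k t. \<forall>y\<in>G. 2 * real k \<le> t \<longrightarrow>
      \<bar>enn2real (P t (indicator A) y) - limit_prob A\<bar> \<le> (1 - e) ^ k"
    using uniform_convergence by (elim exE conjE)
  note u = u[rule_format]
  have o: "origin \<in> space S" by (rule gap_space_sub[OF origin_G])
  have pos: "positive ?M ?\<mu>"
  proof -
    have "prob_at k {} = 0" for k
      using P_const[OF origin_G, of "2 * real k" 0] by (simp add: prob_at_def indicator_def[abs_def])
    then have "limit_prob {} = 0"
      using LIMSEQ_unique[OF prob_at_LIMSEQ[of "{}"]] by fastforce
    then show ?thesis by (simp add: positive_def)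
  qed
  have add: "additive ?M ?\<mu>"
    unfolding additive_def
  proof (intro ballI impI)
    fix A B assume AB: "A \<in> ?M" "B \<in> ?M" "A \<inter> B = {}"
    then have m: "A \<in> sets S" "B \<in> sets S" by (auto dest: gap_measure_sets_S)
    have "ennreal (prob_at k (A \<union> B)) = ennreal (prob_at k A + prob_at k B)" for k
    proof -
      have "P (2 * real k) (indicator (A \<union> B)) origin = P (2 * real k) (\<lambda>z. indicator A z + indicator B z) origin"
        using AB(3) by (intro P_cong origin_G) (auto simp: indicator_def)
      also have "\<dots> = P (2 * real k) (indicator A) origin + P (2 * real k) (indicator B) origin"
        using m o by (intro P_add) auto
      finally show ?thesis
        by (simp add: ennreal_prob_at[symmetric]) (simp add: prob_at_def)
    qed
    then have "prob_at k (A \<union> B) = prob_at k A + prob_at k B" for k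
      by (subst (asm) ennreal_inj) (auto simp: prob_at_def)
    then have "limit_prob (A \<union> B) = limit_prob A + limit_prob B"
      using m by (intro LIMSEQ_unique[OF prob_at_LIMSEQ]) (auto intro!: tendsto_add prob_at_LIMSEQ)
    then show "?\<mu> (A \<union> B) = ?\<mu> A + ?\<mu> B"
      using m limit_prob_nonneg by simp
  qed
  have cont: "(\<lambda>i. ?\<mu> (A i)) \<longlonglongrightarrow> 0" if A: "range A \<subseteq> ?M" "decseq A" "(\<Inter>i. A i) = {}" for A
  proof -
    have m: "A i \<in> sets S" for i using A(1) gap_measure_sets_S by auto
    have "(\<lambda>i. limit_prob (A i)) \<longlonglongrightarrow> 0"
    proof (rule LIMSEQ_I)
      fix r :: real assume r: "0 < r"
      obtain k where k: "(1 - e) ^ k < r / 2"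
        using real_arch_pow_inv[OF half_gt_zero[OF r], of "1 - e"] e by auto
      obtain i0 where i0: "\<And>i. i0 \<le> i \<Longrightarrow> prob_at k (A i) < r / 2"
        using order_tendstoD(2)[OF prob_at_decseq_LIMSEQ[of A k], of "r / 2"] m A r
        by (auto simp: eventually_sequentially)
      have "norm (limit_prob (A i) - 0) < r" if "i0 \<le> i" for i
        using u[OF m origin_G, of k "2 * real k" i] i0[OF that] k origin_G limit_prob_nonneg[OF m, of i]
        by (simp add: prob_at_def)
      then show "\<exists>no. \<forall>i\<ge>no. norm (limit_prob (A i) - 0) < r" by blast
    qed
    then show ?thesis using tendsto_ennrealI by fastforce
  qed
  have "countably_additive ?M ?\<mu>"
    by (rule ring_of_sets.empty_continuous_imp_countably_additive[OF sets.ring_of_sets_axioms pos add _ cont]) auto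
  then show ?thesis
    unfolding invariant_law_def using pos assms sets.sigma_algebra_axioms[of "gap_measure n"]
    by (intro emeasure_measure_of_sigma) (auto simp: space_gap_measure)
qed

section \<open>The limit as a probability measure on the gap space\<close>

lemma sets_invariant_law: "sets invariant_law = sets (gap_measure n)"
  unfolding invariant_law_def
  using sets.sigma_sets_eq[of "gap_measure n"] sets.space_closed[of "gap_measure n"]
  by (simp add: space_gap_measure)

lemma space_invariant_law: "space invariant_law = G"
  using sets_eq_imp_space_eq[OF sets_invariant_law] by (simp add: space_gap_measure)

lemma measure_invariant_law:
  "A \<in> sets (gap_measure n) \<Longrightarrow> measure invariant_law A = limit_prob A"
  using emeasure_invariant_law limit_prob_nonneg[OF gap_measure_sets_S] by (simp add: measure_def)

lemma gap_space_in_gap_measure: "G \<in> sets (gap_measure n)"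
  using gap_space_sets by (simp add: sets_gap_measure)

lemma prob_space_invariant_law: "prob_space invariant_law"
proof
  have "prob_at k G = 1" for k
  proof -
    have "P (2 * real k) (indicator G) origin = P (2 * real k) (\<lambda>_. 1) origin"
      by (intro P_cong origin_G) auto
    then show ?thesis using P_one[OF origin_G, of "2 * real k"] by (simp add: prob_at_def)
  qed
  then have "limit_prob G = 1"
    using LIMSEQ_unique[OF prob_at_LIMSEQ[OF gap_space_sets], of 1] by simp
  then show "emeasure invariant_law (space invariant_law) = 1"
    using emeasure_invariant_law[OF gap_space_in_gap_measure] by (simp add: space_invariant_law)
qed

lemma measurable_gap_measure:
  assumes "f \<in> borel_measurable S" "sets M = sets (gap_measure n)"
  shows "f \<in> borel_measurable M"
proof -
  have "f \<in> borel_measurable (gap_measure n)"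
    unfolding gap_measure_def by (rule measurable_restrict_space1[OF assms(1)])
  then show ?thesis unfolding measurable_cong_sets[OF assms(2) refl] .
qed

text \<open>Stationarity needs the limit for \<open>P t (indicator A)\<close>, which is no
  indicator. Dominated convergence over the level \<open>u\<close> reduces it to setwise convergence
  on superlevel sets.\<close>

lemma nn_integral_invariant_law:
  assumes [measurable]: "f \<in> borel_measurable S" and f: "\<And>z. z \<in> G \<Longrightarrow> f z \<le> 1"
  shows "(\<lambda>k. P (2 * real k) f origin) \<longlonglongrightarrow> (\<integral>\<^sup>+z. f z \<partial>invariant_law)"
proof -
  interpret pi: prob_space invariant_law by (rule prob_space_invariant_law)
  interpret pair_sigma_finite "lborel :: real measure" invariant_law ..
  define A where "A u = {z \<in> space S. ennreal u < f z}" for u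
  define F :: "real \<Rightarrow> _" where "F u z = indicator {0..1} u * (indicator (A u) z :: ennreal)" for u z
  have A[measurable]: "A u \<in> sets S" for u unfolding A_def by measurable
  have mF: "(\<lambda>(u,z). F u z) \<in> borel_measurable (lborel \<Otimes>\<^sub>M S)"
    unfolding F_def A_def indicator_def by measurable
  have layer: "f z = (\<integral>\<^sup>+u. F u z \<partial>lborel)" if z: "z \<in> G" for z
  proof -
    obtain r where r: "0 \<le> r" "r \<le> 1" "f z = ennreal r"
      using f[OF z] by (cases "f z") (auto simp: top_unique)
    have "(\<integral>\<^sup>+u. F u z \<partial>lborel) = (\<integral>\<^sup>+u. indicator {0..<r} u \<partial>lborel)"
      using r gap_space_sub[OF z] by (intro nn_integral_cong) (auto simp: F_def A_def indicator_def ennreal_less_iff)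
    then show ?thesis using r by simp
  qed
  have P_layer: "P t f origin = (\<integral>\<^sup>+u. indicator {0..1} u * P t (indicator (A u)) origin \<partial>lborel)" if "0 \<le> t" for t
  proof -
    have o: "origin \<in> space S" by (rule gap_space_sub[OF origin_G])
    have "P t f origin = P t (\<lambda>z. \<integral>\<^sup>+u. F u z \<partial>lborel) origin"
      using origin_G that layer by (rule P_cong)
    also have "\<dots> = (\<integral>\<^sup>+u. P t (F u) origin \<partial>lborel)"
      using o by (intro P_nn_integral mF lborel.sigma_finite_measure_axioms)
    also have "\<dots> = (\<integral>\<^sup>+u. indicator {0..1} u * P t (indicator (A u)) origin \<partial>lborel)"
      unfolding F_def using o by (simp add: P_cmult)
    finally show ?thesis .
  qed
  have P_meas: "(\<lambda>u. P t (indicator (A u)) origin) \<in> borel_measurable lborel" for t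
  proof -
    have "(\<lambda>(u,z). indicator (A u) z :: ennreal) \<in> borel_measurable (lborel \<Otimes>\<^sub>M S)"
      unfolding A_def indicator_def by measurable
    note m = measurable_T_pow[OF measurable_stay_param[OF this]]
    have [measurable]: "(\<lambda>u. (T ^^ k) (stay (indicator (A u))) t origin) \<in> borel_measurable lborel" for k
      by (rule measurable_uncurry3[OF m]) (use gap_space_sub[OF origin_G] in auto)
    show ?thesis unfolding P_def by measurable
  qed
  have lim: "(\<lambda>k. P (2 * real k) (indicator B) origin) \<longlonglongrightarrow> ennreal (limit_prob B)" if "B \<in> sets S" for B
    unfolding ennreal_prob_at[symmetric] by (rule tendsto_ennrealI[OF prob_at_LIMSEQ[OF that]])
  \<comment> \<open>\<open>A u\<close> may leave \<open>G\<close>, on which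
    \<open>invariant_law\<close> lives; the process started at \<open>origin\<close> does not see
    the difference.\<close>
  have lim_G: "limit_prob (A u) = limit_prob (A u \<inter> G)" for u
  proof -
    have "prob_at k (A u) = prob_at k (A u \<inter> G)" for k
      unfolding prob_at_def by (intro arg_cong[where f=enn2real] P_cong origin_G) (auto simp: indicator_def)
    then show ?thesis by (simp add: limit_prob_def)
  qed
  have "(\<lambda>k. \<integral>\<^sup>+u. indicator {0..1} u * P (2 * real k) (indicator (A u)) origin \<partial>lborel)
      \<longlonglongrightarrow> (\<integral>\<^sup>+u. indicator {0..1} u * ennreal (limit_prob (A u)) \<partial>lborel)"
  proof (rule nn_integral_dominated_convergence[where w="indicator {0..1}"])
    show "(\<lambda>u. indicator {0..1} u * P (2 * real k) (indicator (A u)) origin) \<in> borel_measurable lborel" for k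
      using P_meas by measurable
    have "(\<lambda>u. ennreal (limit_prob (A u))) \<in> borel_measurable lborel"
      by (rule borel_measurable_LIMSEQ_order[OF lim[OF A] P_meas])
    then show "(\<lambda>u. indicator {0..1} u * ennreal (limit_prob (A u))) \<in> borel_measurable lborel"
      by measurable
    show "AE u in lborel. indicator {0..1} u * P (2 * real k) (indicator (A u)) origin \<le> indicator {0..1} u" for k
      using P_indicator_le_1[OF origin_G] by (auto simp: indicator_def)
    show "AE u in lborel. (\<lambda>k. indicator {0..1} u * P (2 * real k) (indicator (A u)) origin)
        \<longlonglongrightarrow> indicator {0..1} u * ennreal (limit_prob (A u))"
      using lim[OF A] by (auto simp: indicator_def)
  qed auto
  moreover have "(\<integral>\<^sup>+u. indicator {0..1} u * ennreal (limit_prob (A u)) \<partial>lborel) = (\<integral>\<^sup>+z. f z \<partial>invariant_law)"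
  proof -
    have mF': "(\<lambda>(u,z). F u z) \<in> borel_measurable (lborel \<Otimes>\<^sub>M invariant_law)"
    proof -
      have "(\<lambda>z. z) \<in> measurable invariant_law S"
        using measurable_restrict_space1[OF measurable_ident, of S G]
          measurable_cong_sets[OF sets_invariant_law refl, of S] by (simp add: gap_measure_def id_def)
      then have [measurable]: "(\<lambda>p. snd p) \<in> measurable (lborel \<Otimes>\<^sub>M invariant_law) S"
        by (rule measurable_compose[OF measurable_snd])
      have "(\<lambda>p. (fst p, snd p)) \<in> measurable (lborel \<Otimes>\<^sub>M invariant_law) (lborel \<Otimes>\<^sub>M S)"
        by measurable
      from measurable_compose[OF this mF] show ?thesis by (simp add: case_prod_beta')
    qed
    have "(\<integral>\<^sup>+z. f z \<partial>invariant_law) = (\<integral>\<^sup>+z. (\<integral>\<^sup>+u. F u z \<partial>lborel) \<partial>invariant_law)"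
      by (intro nn_integral_cong layer) (simp add: space_invariant_law)
    also have "\<dots> = (\<integral>\<^sup>+u. (\<integral>\<^sup>+z. F u z \<partial>invariant_law) \<partial>lborel)"
      using mF' by (rule Fubini')
    also have "\<dots> = (\<integral>\<^sup>+u. indicator {0..1} u * ennreal (limit_prob (A u)) \<partial>lborel)"
    proof (intro nn_integral_cong)
      fix u
      have "A u \<inter> G \<in> sets (gap_measure n)" using gap_space_sets by (simp add: sets_gap_measure)
      then have AG: "A u \<inter> G \<in> sets invariant_law" "emeasure invariant_law (A u \<inter> G) = ennreal (limit_prob (A u))"
        by (simp_all add: sets_invariant_law emeasure_invariant_law lim_G[of u])
      have "(\<integral>\<^sup>+z. F u z \<partial>invariant_law) = (\<integral>\<^sup>+z. indicator {0..1} u * indicator (A u \<inter> G) z \<partial>invariant_law)"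
        by (intro nn_integral_cong) (auto simp: F_def space_invariant_law indicator_def)
      then show "(\<integral>\<^sup>+z. F u z \<partial>invariant_law) = indicator {0..1} u * ennreal (limit_prob (A u))"
        using AG by (simp add: nn_integral_cmult)
    qed
    finally show ?thesis ..
  qed
  ultimately show ?thesis using P_layer by simp
qed

text \<open>One sequence is evaluated in two ways: as integrals of \<open>P t (indicator A)\<close>,
  and by the semigroup law as probabilities at time 2 k + t.\<close>

lemma stationary_invariant_law: "stationary n \<theta> invariant_law"
  unfolding stationary_def suminf_ptrans_k
proof (intro conjI allI impI ballI prob_space_invariant_law sets_invariant_law)
  fix t :: real and A assume t: "0 \<le> t" and A: "A \<in> sets (gap_measure n)"
  have A': "A \<in> sets S" by (rule gap_measure_sets_S[OF A])
  obtain e where e: "0 < e" "e < 1" and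
    u: "\<forall>A\<in>sets S. \<forall>k t. \<forall>y\<in>G. 2 * real k \<le> t \<longrightarrow>
      \<bar>enn2real (P t (indicator A) y) - limit_prob A\<bar> \<le> (1 - e) ^ k"
    using uniform_convergence by (elim exE conjE)
  note u = u[rule_format]
  have "(\<lambda>k. P (2 * real k) (P t (indicator A)) origin) \<longlonglongrightarrow> (\<integral>\<^sup>+y. P t (indicator A) y \<partial>invariant_law)"
    using A' t by (intro nn_integral_invariant_law P_indicator_le_1) auto
  moreover have "(\<lambda>k. P (2 * real k) (P t (indicator A)) origin) \<longlonglongrightarrow> ennreal (limit_prob A)"
  proof -
    have eq: "P (2 * real k) (P t (indicator A)) origin = ennreal (enn2real (P (2 * real k + t) (indicator A) origin))" for k
    proof -
      have "P (2 * real k + t) (indicator A) origin < \<top>"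
        by (rule order.strict_trans1[OF P_indicator_le_1[OF origin_G]]) (use t in auto)
      then show ?thesis
        using P_semigroup[of "indicator A" origin "2 * real k" t] A' t gap_space_sub[OF origin_G] by simp
    qed
    have "(\<lambda>k. enn2real (P (2 * real k + t) (indicator A) origin) - limit_prob A) \<longlonglongrightarrow> 0"
    proof (rule Lim_null_comparison)
      show "\<forall>\<^sub>F k in sequentially. norm (enn2real (P (2 * real k + t) (indicator A) origin) - limit_prob A) \<le> (1 - e) ^ k"
        using u[OF A' origin_G] t by simp
      show "(\<lambda>k. (1 - e) ^ k) \<longlonglongrightarrow> 0" using e by (intro LIMSEQ_realpow_zero) auto
    qed
    then show ?thesis unfolding eq by (intro tendsto_ennrealI) (simp add: LIM_zero_iff)
  qed
  ultimately show "emeasure invariant_law A = (\<integral>\<^sup>+y. P t (indicator A) y \<partial>invariant_law)"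
    using emeasure_invariant_law[OF A] LIMSEQ_unique by metis
qed

text \<open>Stationarity makes the mass of \<open>A\<close> an average over starting points of
  values that all lie within \<open>(1 - e) ^ k\<close> of \<open>limit_prob A\<close>.\<close>

lemma stationary_unique:
  assumes \<pi>: "stationary n \<theta> \<pi>"
  shows "\<pi> = invariant_law"
proof (rule measure_eqI)
  interpret prob_space \<pi> using \<pi> by (simp add: stationary_def)
  have sets: "sets \<pi> = sets (gap_measure n)" using \<pi> by (simp add: stationary_def)
  then show "sets \<pi> = sets invariant_law" by (simp add: sets_invariant_law)
  have space: "space \<pi> = G" using sets_eq_imp_space_eq[OF sets] by (simp add: space_gap_measure)
  obtain e where e: "0 < e" "e < 1" and
    u: "\<forall>A\<in>sets S. \<forall>k t. \<forall>y\<in>G. 2 * real k \<le> t \<longrightarrow>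
      \<bar>enn2real (P t (indicator A) y) - limit_prob A\<bar> \<le> (1 - e) ^ k"
    using uniform_convergence by (elim exE conjE)
  note u = u[rule_format]
  fix A assume "A \<in> sets \<pi>"
  then have A: "A \<in> sets (gap_measure n)" by (simp add: sets)
  have A': "A \<in> sets S" by (rule gap_measure_sets_S[OF A])
  have bnd: "\<bar>measure \<pi> A - limit_prob A\<bar> \<le> (1 - e) ^ k" for k
  proof -
    let ?f = "\<lambda>y. enn2real (P (2 * real k) (indicator A) y)"
    have P1: "P (2 * real k) (indicator A) y \<le> 1" if "y \<in> G" for y
      by (rule P_indicator_le_1[OF that]) simp
    have fin: "ennreal (?f y) = P (2 * real k) (indicator A) y" if "y \<in> G" for y
      using order.strict_trans1[OF P1[OF that], of \<top>] by simp
    have f1: "?f y \<le> 1" if "y \<in> G" for y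
      using P1[OF that] by (intro enn2real_leI) auto
    have m: "?f \<in> borel_measurable \<pi>"
      using A' by (intro borel_measurable_enn2real measurable_gap_measure[OF _ sets]) auto
    have int: "integrable \<pi> ?f"
      by (rule integrable_const_bound[where B=1]) (use m f1 space in auto)
    have "emeasure \<pi> A = (\<integral>\<^sup>+y. P (2 * real k) (indicator A) y \<partial>\<pi>)"
      using \<pi> A by (simp add: stationary_def suminf_ptrans_k)
    also have "\<dots> = (\<integral>\<^sup>+y. ennreal (?f y) \<partial>\<pi>)"
      by (intro nn_integral_cong) (simp add: fin space)
    also have "\<dots> = ennreal (\<integral>y. ?f y \<partial>\<pi>)"
      by (rule nn_integral_eq_integral[OF int]) simp
    finally have "measure \<pi> A = (\<integral>y. ?f y \<partial>\<pi>)"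
      by (simp add: measure_def)
    then have "measure \<pi> A - limit_prob A = (\<integral>y. ?f y - limit_prob A \<partial>\<pi>)"
      using int by (simp add: prob_space)
    also have "\<bar>\<dots>\<bar> \<le> (\<integral>y. \<bar>?f y - limit_prob A\<bar> \<partial>\<pi>)"
      by (rule integral_abs_bound)
    also have "\<dots> \<le> (\<integral>y. (1 - e) ^ k \<partial>\<pi>)"
      using int by (intro integral_mono) (auto simp: space intro!: u A')
    finally show ?thesis by (simp add: prob_space)
  qed
  have "(\<lambda>k. (1 - e) ^ k) \<longlonglongrightarrow> 0" using e by (intro LIMSEQ_realpow_zero) auto
  then have "\<bar>measure \<pi> A - limit_prob A\<bar> \<le> 0"
    by (rule LIMSEQ_le_const) (use bnd in auto)
  then show "emeasure \<pi> A = emeasure invariant_law A"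
    using emeasure_invariant_law[OF A] by (simp add: emeasure_eq_measure)
qed

lemma exponential_convergence:
  "\<exists>\<kappa> \<beta>. 0 < \<kappa> \<and> 0 < \<beta> \<and> \<beta> < 1 \<and> (\<forall>t>0. \<forall>y\<in>G. \<forall>A\<in>sets (gap_measure n).
     \<bar>Ptrans n \<theta> t y A - measure invariant_law A\<bar> \<le> \<kappa> * \<beta> powr t)"
proof -
  obtain e where e: "0 < e" "e < 1" and
    u: "\<forall>A\<in>sets S. \<forall>k t. \<forall>y\<in>G. 2 * real k \<le> t \<longrightarrow>
      \<bar>enn2real (P t (indicator A) y) - limit_prob A\<bar> \<le> (1 - e) ^ k"
    using uniform_convergence by (elim exE conjE)
  note u = u[rule_format]
  \<comment> \<open>A contraction by 1 - e takes two time units, hence the square root; rounding t /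
    2 down loses at most one factor, which \<open>?\<kappa>\<close> restores.\<close>
  let ?\<kappa> = "1 / (1 - e)" and ?\<beta> = "(1 - e) powr (1 / 2)"
  have "\<bar>Ptrans n \<theta> t y A - measure invariant_law A\<bar> \<le> ?\<kappa> * ?\<beta> powr t"
    if t: "0 < t" and y: "y \<in> G" and A: "A \<in> sets (gap_measure n)" for t y A
  proof -
    define k where "k = nat \<lfloor>t / 2\<rfloor>"
    have k: "real k \<le> t / 2" "t / 2 \<le> real k + 1" using t unfolding k_def by linarith+
    have "\<bar>Ptrans n \<theta> t y A - measure invariant_law A\<bar> \<le> (1 - e) ^ k"
      using u[OF gap_measure_sets_S[OF A] y, of k t] k
      by (simp add: Ptrans_def suminf_ptrans_k measure_invariant_law[OF A])
    also have "\<dots> = (1 - e) powr real k" using e by (simp add: powr_realpow)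
    also have "\<dots> \<le> (1 - e) powr (t / 2 - 1)"
      using e k by (intro powr_mono') auto
    also have "\<dots> = ?\<kappa> * ?\<beta> powr t"
      using e by (simp add: powr_diff powr_powr)
    finally show ?thesis .
  qed
  moreover have "?\<beta> < 1" using e powr_less_mono'[of "1 - e" 0 "1/2"] by simp
  ultimately show ?thesis using e by (intro exI[of _ ?\<kappa>] exI[of _ ?\<beta>]) auto
qed

end

theorem theorem3p2:
  fixes n :: nat and \<theta> :: "real measure"
  assumes n2: "n \<ge> 2"
    and theta_prob: "prob_space \<theta>" and theta_sets: "sets \<theta> = sets (borel :: real measure)"
    and theta_pos: "emeasure \<theta> {0<..} = 1"
    and theta_int: "integrable \<theta> (\<lambda>z. z)" and theta_mean: "(\<integral>z. z \<partial>\<theta>) = 1"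
  shows "\<exists>\<pi>. stationary n \<theta> \<pi> \<and> (\<forall>\<pi>'. stationary n \<theta> \<pi>' \<longrightarrow> \<pi>' = \<pi>) \<and>
           (\<exists>\<kappa> \<beta>. 0 < \<kappa> \<and> 0 < \<beta> \<and> \<beta> < 1 \<and>
              (\<forall>t>0. \<forall>y\<in>gap_space n. \<forall>A\<in>sets (gap_measure n).
                 \<bar>Ptrans n \<theta> t y A - measure \<pi> A\<bar> \<le> \<kappa> * \<beta> powr t))"
proof -
  interpret follow_the_leader n \<theta>
    by (rule follow_the_leader.intro) (rule assms)+
  show ?thesis
    using stationary_invariant_law stationary_unique exponential_convergence by blast
qed

end
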